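(* Let $(Y_1,Z_1,W_1),\dots,(Y_n,Z_n,W_n)$ be an i.i.d. sample of $(Y,Z,W)$ from the model $Y=\varphi(Z)+U$, $\mathbb E[U\mid W]=0$. Let $\gamma$ and $\upsilon$ be sequences satisfying Assumptions 1 and 2 (written out in the context), and let $h\in\mathcal F_{1/\gamma}$, $\rho>0$, $d\ge 1$. Suppose that $\sup_{j\ge1}\mathbb E[e_j^4(Z)\mid W]\le\eta^4$ with $\eta\ge1$, and that $\sigma^4\ge\big(\sqrt3+4\rho\,\eta^2\sum_{j\ge1}\gamma_j^{-1}\big)^2$. Then for all $n\ge1$ $$\inf_{\breve\ell}\ \inf_{T\in\mathcal T_d^\upsilon}\ \sup_{P_{U|W}\in\mathcal U_\sigma}\ \sup_{\varphi\in\mathcal F_\gamma^\rho}\ \mathbb E|\breve\ell-\ell_h(\varphi)|^2\ \ge\ \frac{\kappa}{4}\,\min\Big(\frac1{2d},\rho\Big)\,\mathcal R^h_n ,$$ where the first infimum runs over all possible estimators $\breve\ell$ (measurable functions of the sample).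
   Context: Model: $Y=\varphi(Z)+U$ with $\mathbb E[U\mid W]=0$ (and in general $\mathbb E[U\mid Z]\neq0$). $L^2_Z=\{\phi:\mathbb E[\phi^2(Z)]<\infty\}$ and $L^2_W=\{\psi:\mathbb E[\psi^2(W)]<\infty\}$ carry their usual inner products $\langle\cdot,\cdot\rangle_Z$, $\langle\cdot,\cdot\rangle_W$. The conditional expectation operator is $T:L^2_Z\to L^2_W$, $T\phi=\mathbb E[\phi(Z)\mid W]$; it is assumed compact and injective. $\{e_j\}_{j\ge1}$ is a fixed orthonormal basis of $L^2_Z$ and $[\phi]_j=\langle\phi,e_j\rangle_Z$. For a positive sequence $w=(w_j)_{j\ge1}$, $\|\phi\|_w^2=\sum_{j\ge1}w_j[\phi]_j^2$, $\mathcal F_w$ is the associated (completed) weighted space, identified with the coefficient sequences of finite $\|\cdot\|_w$-norm, and $\mathcal F_w^r=\{\phi\in\mathcal F_w:\|\phi\|_w^2\le r\}$. With $1/\gamma=(\gamma_j^{-1})_j$, for $h\in\mathcal F_{1/\gamma}$ and $\phi\in\mathcal F_\gamma$ put $\ell_h(\phi)=\sum_{j\ge1}[h]_j[\phi]_j$. $\mathcal T_d^\upsilon$ is the set of compact operators $T:L^2_Z\to L^2_W$ with $\|\phi\|_\upsilon^2/d\le\|T\phi\|_W^2\le d\|\phi\|_\upsilon^2$ for all $\phi\in L^2_Z$. $\mathcal U_\sigma$ is the set of conditional distributions $P_{U|W}$ of $U$ given $W$ with $\mathbb E[U\mid W]=0$ and $\mathbb E[U^4\mid W]\le\sigma^4$.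 The infimum over $T$ and the suprema over $P_{U|W},\varphi$ range over joint laws of $(U,Z,W)$ and functions $\varphi$ such that the conditional expectation operator of $Z$ given $W$, the conditional law of $U$ given $W$, and $\varphi$ lie in the indicated classes (the moment condition on $e_j(Z)$ given $W$ being in force); $\mathbb E$ is expectation under the resulting law of the sample. Assumption 1 (part on $\gamma,\upsilon$): $\gamma,\upsilon$ are strictly positive sequences with $\gamma_1=\upsilon_1=1$; $\gamma$ is nondecreasing with $j^3\gamma_j^{-1}\to0$ as $j\to\infty$; $\upsilon$ is nonincreasing with $\lim_j\upsilon_j=0$. For $x\ge1$ let $$m^*_x=\operatorname*{arg\,min}_{m\in\mathbb N}\frac{\max\{\upsilon_m/\gamma_m,x^{-1}\}}{\min\{\upsilon_m/\gamma_m,x^{-1}\}}\ \text{(the smallest minimizer)},\qquad \alpha^*_x=\max\Big\{\frac{\upsilon_{m^*_x}}{\gamma_{m^*_x}},x^{-1}\Big\},$$ $$\mathcal R^h_x=\max\Big\{\alpha^*_x\sum_{j=1}^{m^*_x}\frac{[h]_j^2}{\upsilon_j},\ \sum_{j>m^*_x}\frac{[h]_j^2}{\gamma_j}\Big\}.$$ Assumption 2: $0<\kappa:=\inf_{n\ge1}\big\{(\alpha^*_n)^{-1}\min\{\upsilon_{m^*_n}/\gamma_{m^*_n},n^{-1}\}\big\}\le1$. *)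

theory Defs
  imports "HOL-Probability.Probability"
begin

text \<open>
  The laws \<open>PZ\<close>, \<open>PW\<close> of \<open>Z\<close>, \<open>W\<close> are arbitrary probability measures. Elements of \<open>L2\<close> are
  represented by functions and identified when almost everywhere equal. Sequences are functions
  on \<^typ>\<open>nat\<close> whose value at \<open>0\<close> is never used: the index ranges over \<open>{1..}\<close> throughout.
\<close>

subsection \<open>Square integrable functions and operators between them\<close>

definition L2 :: "'a measure \<Rightarrow> ('a \<Rightarrow> real) set" where
  "L2 M = {f \<in> borel_measurable M. integrable M (\<lambda>x. (f x)\<^sup>2)}"

definition L2_inner :: "'a measure \<Rightarrow> ('a \<Rightarrow> real) \<Rightarrow> ('a \<Rightarrow> real) \<Rightarrow> real" where
  "L2_inner M f g = (\<integral>x. f x * g x \<partial>M)"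

definition L2_norm :: "'a measure \<Rightarrow> ('a \<Rightarrow> real) \<Rightarrow> real" where
  "L2_norm M f = sqrt (L2_inner M f f)"

definition orthonormal_basis :: "'a measure \<Rightarrow> (nat \<Rightarrow> 'a \<Rightarrow> real) \<Rightarrow> bool" where
  "orthonormal_basis M e \<longleftrightarrow>
     (\<forall>j\<ge>1. e j \<in> L2 M) \<and>
     (\<forall>i\<ge>1. \<forall>j\<ge>1. L2_inner M (e i) (e j) = (if i = j then 1 else 0)) \<and>
     (\<forall>f\<in>L2 M. (\<lambda>k. L2_norm M (\<lambda>x. f x - (\<Sum>j=1..k. L2_inner M f (e j) * e j x))) \<longlonglongrightarrow> 0)"

text \<open>The second conjunct makes the operator well defined on classes of
  almost everywhere equal functions.\<close>

definition linear_L2 :: "'a measure \<Rightarrow> 'b measure \<Rightarrow> (('a \<Rightarrow> real) \<Rightarrow> ('b \<Rightarrow> real)) \<Rightarrow> bool" where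
  "linear_L2 M N T \<longleftrightarrow>
     (\<forall>f\<in>L2 M. T f \<in> L2 N) \<and>
     (\<forall>f\<in>L2 M. \<forall>g\<in>L2 M. (AE x in M. f x = g x) \<longrightarrow> (AE y in N. T f y = T g y)) \<and>
     (\<forall>f\<in>L2 M. \<forall>g\<in>L2 M. \<forall>a b. AE y in N. T (\<lambda>x. a * f x + b * g x) y = a * T f y + b * T g y)"

definition compact_L2 :: "'a measure \<Rightarrow> 'b measure \<Rightarrow> (('a \<Rightarrow> real) \<Rightarrow> ('b \<Rightarrow> real)) \<Rightarrow> bool" where
  "compact_L2 M N T \<longleftrightarrow> linear_L2 M N T \<and>
     (\<forall>f :: nat \<Rightarrow> 'a \<Rightarrow> real. \<forall>C. (\<forall>n. f n \<in> L2 M \<and> L2_norm M (f n) \<le> C) \<longrightarrow>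
        (\<exists>g\<in>L2 N. \<exists>r. strict_mono r \<and> (\<lambda>n. L2_norm N (\<lambda>y. T (f (r n)) y - g y)) \<longlonglongrightarrow> 0))"

definition injective_L2 :: "'a measure \<Rightarrow> 'b measure \<Rightarrow> (('a \<Rightarrow> real) \<Rightarrow> ('b \<Rightarrow> real)) \<Rightarrow> bool" where
  "injective_L2 M N T \<longleftrightarrow>
     (\<forall>f\<in>L2 M. \<forall>g\<in>L2 M. (AE y in N. T f y = T g y) \<longrightarrow> (AE x in M. f x = g x))"

subsection \<open>Weighted spaces\<close>

definition coeffs :: "'a measure \<Rightarrow> (nat \<Rightarrow> 'a \<Rightarrow> real) \<Rightarrow> ('a \<Rightarrow> real) \<Rightarrow> nat \<Rightarrow> real" where
  "coeffs M e \<phi> j = L2_inner M \<phi> (e j)"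

definition wnorm_sq :: "(nat \<Rightarrow> real) \<Rightarrow> (nat \<Rightarrow> real) \<Rightarrow> real" where
  "wnorm_sq w c = (\<Sum>\<^sub>\<infinity>j\<in>{1..}. w j * (c j)\<^sup>2)"

definition F_space :: "(nat \<Rightarrow> real) \<Rightarrow> (nat \<Rightarrow> real) set" where
  "F_space w = {c. (\<lambda>j. w j * (c j)\<^sup>2) summable_on {1..}}"

definition F_ball :: "(nat \<Rightarrow> real) \<Rightarrow> real \<Rightarrow> (nat \<Rightarrow> real) set" where
  "F_ball w r = {c \<in> F_space w. wnorm_sq w c \<le> r}"

text \<open>The same ball as a set of functions. Every sequence in the ball is the coefficient sequence
  of a function in \<open>L2\<close> as soon as the weights are bounded away from \<open>0\<close>.\<close>

definition F_ball_fun ::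
  "'a measure \<Rightarrow> (nat \<Rightarrow> 'a \<Rightarrow> real) \<Rightarrow> (nat \<Rightarrow> real) \<Rightarrow> real \<Rightarrow> ('a \<Rightarrow> real) set" where
  "F_ball_fun M e w r = {\<phi> \<in> L2 M. coeffs M e \<phi> \<in> F_ball w r}"

definition ell :: "(nat \<Rightarrow> real) \<Rightarrow> (nat \<Rightarrow> real) \<Rightarrow> real" where
  "ell h c = (\<Sum>\<^sub>\<infinity>j\<in>{1..}. h j * c j)"

definition T_class ::
  "'z measure \<Rightarrow> 'w measure \<Rightarrow> (nat \<Rightarrow> 'z \<Rightarrow> real) \<Rightarrow> (nat \<Rightarrow> real) \<Rightarrow> real
    \<Rightarrow> (('z \<Rightarrow> real) \<Rightarrow> ('w \<Rightarrow> real)) set" where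
  "T_class PZ PW e \<upsilon> d = {T. compact_L2 PZ PW T \<and>
     (\<forall>\<phi>\<in>L2 PZ. wnorm_sq \<upsilon> (coeffs PZ e \<phi>) / d \<le> (L2_norm PW (T \<phi>))\<^sup>2 \<and>
                 (L2_norm PW (T \<phi>))\<^sup>2 \<le> d * wnorm_sq \<upsilon> (coeffs PZ e \<phi>))}"

subsection \<open>Laws of the observations and of the error\<close>

text \<open>The sigma-algebra generated by a random variable with values in \<open>N\<close>.\<close>

definition sigma_of :: "'a measure \<Rightarrow> ('a \<Rightarrow> 'b) \<Rightarrow> 'b measure \<Rightarrow> 'a measure" where
  "sigma_of M X N = vimage_algebra (space M) X N"

text \<open>Joint laws \<open>Q\<close> of \<open>(Z, W)\<close> with the given marginals.\<close>

definition laws_ZW :: "'z measure \<Rightarrow> 'w measure \<Rightarrow> ('z \<times> 'w) measure set" where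
  "laws_ZW PZ PW = {Q. prob_space Q \<and> sets Q = sets (PZ \<Otimes>\<^sub>M PW) \<and>
     distr Q PZ fst = PZ \<and> distr Q PW snd = PW}"

definition is_cond_exp_operator ::
  "'z measure \<Rightarrow> 'w measure \<Rightarrow> ('z \<times> 'w) measure \<Rightarrow> (('z \<Rightarrow> real) \<Rightarrow> ('w \<Rightarrow> real)) \<Rightarrow> bool" where
  "is_cond_exp_operator PZ PW Q T \<longleftrightarrow>
     (\<forall>\<phi>\<in>L2 PZ. T \<phi> \<in> L2 PW \<and>
        (AE x in Q. T \<phi> (snd x) = real_cond_exp Q (sigma_of Q snd PW) (\<lambda>x. \<phi> (fst x)) x))"

text \<open>Fourth moments are conditional expectations of nonnegative functions with values in
  \<^typ>\<open>ennreal\<close>, so that an infinite moment violates the bounds below.\<close>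

definition basis_moment_bound ::
  "'w measure \<Rightarrow> (nat \<Rightarrow> 'z \<Rightarrow> real) \<Rightarrow> real \<Rightarrow> ('z \<times> 'w) measure \<Rightarrow> bool" where
  "basis_moment_bound PW e \<eta> Q \<longleftrightarrow>
     (AE x in Q. (SUP j\<in>{1..}. nn_cond_exp Q (sigma_of Q snd PW) (\<lambda>x. ennreal ((e j (fst x))^4)) x)
        \<le> ennreal (\<eta>^4))"

text \<open>\<open>admissible_ZW PZ PW e \<eta> T\<close> are the joint laws of \<open>(Z, W)\<close> for which \<open>T\<close> is the conditional
  expectation operator of \<open>Z\<close> given \<open>W\<close> and the moment condition on the basis is in force.\<close>

definition admissible_ZW ::
  "'z measure \<Rightarrow> 'w measure \<Rightarrow> (nat \<Rightarrow> 'z \<Rightarrow> real) \<Rightarrow> real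
    \<Rightarrow> (('z \<Rightarrow> real) \<Rightarrow> ('w \<Rightarrow> real)) \<Rightarrow> ('z \<times> 'w) measure set" where
  "admissible_ZW PZ PW e \<eta> T =
     {Q \<in> laws_ZW PZ PW. is_cond_exp_operator PZ PW Q T \<and> basis_moment_bound PW e \<eta> Q}"

definition admissible_T ::
  "'z measure \<Rightarrow> 'w measure \<Rightarrow> (nat \<Rightarrow> 'z \<Rightarrow> real) \<Rightarrow> real \<Rightarrow> (nat \<Rightarrow> real) \<Rightarrow> real
    \<Rightarrow> (('z \<Rightarrow> real) \<Rightarrow> ('w \<Rightarrow> real)) set" where
  "admissible_T PZ PW e \<eta> \<upsilon> d =
     {T \<in> T_class PZ PW e \<upsilon> d. injective_L2 PZ PW T \<and> admissible_ZW PZ PW e \<eta> T \<noteq> {}}"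

text \<open>Membership in \<open>U_class PW \<sigma>\<close> restricts a joint law of \<open>(U, (Z, W))\<close> only through the
  conditional law of \<open>U\<close> given \<open>W\<close>; in particular \<open>U\<close> and \<open>Z\<close> may be dependent given \<open>W\<close>.\<close>

definition U_class :: "'w measure \<Rightarrow> real \<Rightarrow> (real \<times> 'z \<times> 'w) measure set" where
  "U_class PW \<sigma> = {M. integrable M fst \<and>
     (AE x in M. real_cond_exp M (sigma_of M (\<lambda>x. snd (snd x)) PW) fst x = 0) \<and>
     (AE x in M. nn_cond_exp M (sigma_of M (\<lambda>x. snd (snd x)) PW) (\<lambda>x. ennreal ((fst x)^4)) x
        \<le> ennreal (\<sigma>^4))}"

definition obs_algebra :: "'z measure \<Rightarrow> 'w measure \<Rightarrow> (real \<times> 'z \<times> 'w) measure" where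
  "obs_algebra PZ PW = borel \<Otimes>\<^sub>M (PZ \<Otimes>\<^sub>M PW)"

definition admissible_UZW ::
  "'z measure \<Rightarrow> 'w measure \<Rightarrow> (nat \<Rightarrow> 'z \<Rightarrow> real) \<Rightarrow> real \<Rightarrow> real
    \<Rightarrow> (('z \<Rightarrow> real) \<Rightarrow> ('w \<Rightarrow> real)) \<Rightarrow> (real \<times> 'z \<times> 'w) measure set" where
  "admissible_UZW PZ PW e \<eta> \<sigma> T =
     {M \<in> U_class PW \<sigma>. prob_space M \<and> sets M = sets (obs_algebra PZ PW) \<and>
        distr M (PZ \<Otimes>\<^sub>M PW) snd \<in> admissible_ZW PZ PW e \<eta> T}"

text \<open>The law of \<open>(Y, (Z, W))\<close> with \<open>Y = \<phi> Z + U\<close>, where \<open>M\<close> is the law of \<open>(U, (Z, W))\<close>.\<close>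

definition model_law ::
  "'z measure \<Rightarrow> 'w measure \<Rightarrow> (real \<times> 'z \<times> 'w) measure \<Rightarrow> ('z \<Rightarrow> real) \<Rightarrow> (real \<times> 'z \<times> 'w) measure" where
  "model_law PZ PW M \<phi> = distr M (obs_algebra PZ PW) (\<lambda>(u, z, w). (\<phi> z + u, z, w))"

definition estimators ::
  "'z measure \<Rightarrow> 'w measure \<Rightarrow> nat \<Rightarrow> ((nat \<Rightarrow> real \<times> 'z \<times> 'w) \<Rightarrow> real) set" where
  "estimators PZ PW n = borel_measurable (\<Pi>\<^sub>M i\<in>{1..n}. obs_algebra PZ PW)"

text \<open>The mean squared error may be infinite.\<close>

definition risk ::
  "'z measure \<Rightarrow> 'w measure \<Rightarrow> (nat \<Rightarrow> 'z \<Rightarrow> real) \<Rightarrow> (nat \<Rightarrow> real) \<Rightarrow> nat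
    \<Rightarrow> ((nat \<Rightarrow> real \<times> 'z \<times> 'w) \<Rightarrow> real) \<Rightarrow> (real \<times> 'z \<times> 'w) measure \<Rightarrow> ('z \<Rightarrow> real) \<Rightarrow> ennreal" where
  "risk PZ PW e h n l M \<phi> =
     (\<integral>\<^sup>+s. ennreal (\<bar>l s - ell h (coeffs PZ e \<phi>)\<bar>\<^sup>2) \<partial>(\<Pi>\<^sub>M i\<in>{1..n}. model_law PZ PW M \<phi>))"

subsection \<open>Sequences and the rate\<close>

definition regular_weights :: "(nat \<Rightarrow> real) \<Rightarrow> (nat \<Rightarrow> real) \<Rightarrow> bool" where
  "regular_weights \<gamma> \<upsilon> \<longleftrightarrow>
     (\<forall>j\<ge>1. \<gamma> j > 0 \<and> \<upsilon> j > 0) \<and> \<gamma> 1 = 1 \<and> \<upsilon> 1 = 1 \<and>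
     mono_on {1..} \<gamma> \<and> (\<lambda>j. real j ^ 3 / \<gamma> j) \<longlonglongrightarrow> 0 \<and>
     antimono_on {1..} \<upsilon> \<and> \<upsilon> \<longlonglongrightarrow> 0"

definition balance :: "(nat \<Rightarrow> real) \<Rightarrow> (nat \<Rightarrow> real) \<Rightarrow> real \<Rightarrow> nat \<Rightarrow> real" where
  "balance \<gamma> \<upsilon> x m = max (\<upsilon> m / \<gamma> m) (1 / x) / min (\<upsilon> m / \<gamma> m) (1 / x)"

definition m_star :: "(nat \<Rightarrow> real) \<Rightarrow> (nat \<Rightarrow> real) \<Rightarrow> real \<Rightarrow> nat" where
  "m_star \<gamma> \<upsilon> x = (LEAST m. m \<ge> 1 \<and> (\<forall>k\<ge>1. balance \<gamma> \<upsilon> x m \<le> balance \<gamma> \<upsilon> x k))"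

definition alpha_star :: "(nat \<Rightarrow> real) \<Rightarrow> (nat \<Rightarrow> real) \<Rightarrow> real \<Rightarrow> real" where
  "alpha_star \<gamma> \<upsilon> x = max (\<upsilon> (m_star \<gamma> \<upsilon> x) / \<gamma> (m_star \<gamma> \<upsilon> x)) (1 / x)"

definition rate :: "(nat \<Rightarrow> real) \<Rightarrow> (nat \<Rightarrow> real) \<Rightarrow> (nat \<Rightarrow> real) \<Rightarrow> real \<Rightarrow> real" where
  "rate \<gamma> \<upsilon> h x =
     max (alpha_star \<gamma> \<upsilon> x * (\<Sum>j=1..m_star \<gamma> \<upsilon> x. (h j)\<^sup>2 / \<upsilon> j))
         (\<Sum>\<^sub>\<infinity>j\<in>{m_star \<gamma> \<upsilon> x<..}. (h j)\<^sup>2 / \<gamma> j)"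

definition kappa :: "(nat \<Rightarrow> real) \<Rightarrow> (nat \<Rightarrow> real) \<Rightarrow> real" where
  "kappa \<gamma> \<upsilon> = (INF n\<in>{1::nat..}.
     inverse (alpha_star \<gamma> \<upsilon> (real n)) *
     min (\<upsilon> (m_star \<gamma> \<upsilon> (real n)) / \<gamma> (m_star \<gamma> \<upsilon> (real n))) (1 / real n))"

definition balanced_weights :: "(nat \<Rightarrow> real) \<Rightarrow> (nat \<Rightarrow> real) \<Rightarrow> bool" where
  "balanced_weights \<gamma> \<upsilon> \<longleftrightarrow> 0 < kappa \<gamma> \<upsilon> \<and> kappa \<gamma> \<upsilon> \<le> 1"

end

theory Submission
  imports Defs
begin

text \<open>
  Fix a law \<open>Q\<close> of \<open>(Z, W)\<close> compatible with \<open>T\<close>, a finite combination \<open>\<phi>\<close> of basis functions and an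
  independent standard normal \<open>V\<close>. For \<open>t = 1\<close> and \<open>t = -1\<close> take the regression function \<open>t \<phi>\<close> with the
  endogenous error \<open>U = V - t (\<phi>(Z) - (T \<phi>)(W))\<close>. Then \<open>Y = V + t (T \<phi>)(W)\<close>, so the data see \<open>\<phi>\<close> only
  through \<open>T \<phi>\<close>, and the Hellinger affinity of the two sample laws is at least
  \<open>1 - n \<parallel>T \<phi>\<parallel>\<^sup>2 / 2\<close>. If \<open>n \<parallel>T \<phi>\<parallel>\<^sup>2 \<le> 1/2\<close>, no estimator can separate \<open>\<ell>(\<phi>)\<close> from \<open>-\<ell>(\<phi>)\<close>, and
  one of the two risks is at least \<open>\<ell>(\<phi>)\<^sup>2 / 2\<close>. The coefficients \<open>[h]\<^sub>j / \<upsilon>\<^sub>j\<close> on \<open>j \<le> m\<close> and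
  \<open>[h]\<^sub>j / \<gamma>\<^sub>j\<close> on finite subsets of \<open>j > m\<close>, suitably scaled, yield the two terms of the rate.
\<close>

subsection \<open>Conditional moments\<close>

context finite_measure_subalgebra
begin

text \<open>Passage from the extended nonnegative conditional moments of the definitions to the
  calculus of real conditional expectations. Integrating the bound over a space of finite mass gives
  integrability; \<open>real_cond_exp\<close> is the conditional expectation of the positive part
  minus that of the negative part, hence at most the former.\<close>

lemma real_cond_exp_le_of_nn_cond_exp_le:
  assumes [measurable]: "f \<in> borel_measurable M" and "\<And>x. 0 \<le> f x" and "0 \<le> c"
    and le: "AE x in M. nn_cond_exp M F (\<lambda>x. ennreal (f x)) x \<le> ennreal c"
  shows "integrable M f" "AE x in M. real_cond_exp M F f x \<le> c"
proof -
  have "(\<integral>\<^sup>+x. ennreal (f x) \<partial>M) = (\<integral>\<^sup>+x. nn_cond_exp M F (\<lambda>x. ennreal (f x)) x \<partial>M)"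
    using nn_cond_exp_intg[of "\<lambda>_. 1" "\<lambda>x. ennreal (f x)"] by simp
  also have "\<dots> \<le> (\<integral>\<^sup>+x. ennreal c \<partial>M)"
    using le by (rule nn_integral_mono_AE)
  also have "\<dots> < \<infinity>"
    by (simp add: ennreal_mult_eq_top_iff less_top[symmetric])
  finally show "integrable M f"
    using assms by (intro integrableI_nonneg) auto
  show "AE x in M. real_cond_exp M F f x \<le> c"
    using le
  proof eventually_elim
    case (elim x)
    have "real_cond_exp M F f x \<le> enn2real (nn_cond_exp M F (\<lambda>x. ennreal (f x)) x)"
      by (simp add: real_cond_exp_def)
    also have "\<dots> \<le> c"
      using elim \<open>0 \<le> c\<close> by (simp add: enn2real_leI)
    finally show ?case .
  qed
qed

text \<open>The integrated form in which bounds under the law of \<open>(Z, W)\<close> are carried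
  over to the law of the error.\<close>

lemma integral_indicator_le_of_real_cond_exp_le:
  assumes f: "integrable M f" and le: "AE x in M. real_cond_exp M F f x \<le> c" and A: "A \<in> sets F"
  shows "(\<integral>x. indicator A x * f x \<partial>M) \<le> c * measure M A"
proof -
  have AM: "A \<in> sets M" using A subalg by (auto simp: subalgebra_def)
  have i: "integrable M (\<lambda>x. indicator A x * f x)"
    using integrable_mult_indicator[OF AM f] by simp
  have "(\<integral>x. indicator A x * f x \<partial>M) = (\<integral>x. indicator A x * real_cond_exp M F f x \<partial>M)"
    using i A f by (intro real_cond_exp_intg(2)[symmetric]) auto
  also have "\<dots> \<le> (\<integral>x. indicator A x * c \<partial>M)"
  proof (rule integral_mono_AE)
    show "integrable M (\<lambda>x. indicator A x * real_cond_exp M F f x)"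
      using i A f by (intro real_cond_exp_intg(1)) auto
    show "integrable M (\<lambda>x. indicator A x * c)"
      using AM by (intro integrable_mult_left) (auto simp: less_top[symmetric])
    show "AE x in M. indicator A x * real_cond_exp M F f x \<le> indicator A x * c"
      using le by eventually_elim (auto simp: indicator_def)
  qed
  also have "\<dots> = c * measure M A"
    using AM by simp
  finally show ?thesis .
qed

text \<open>Test the hypothesis on the set \<open>A\<close> in \<open>F\<close> where the
  conditional expectation exceeds \<open>c\<close>: the excess over \<open>c\<close> has integral 0
  on \<open>A\<close>, so \<open>A\<close> is negligible. Finiteness of the measure makes the
  subtraction legitimate.\<close>

lemma nn_cond_exp_le_const:
  assumes [measurable]: "f \<in> borel_measurable M"
    and le: "\<And>A. A \<in> sets F \<Longrightarrow> (\<integral>\<^sup>+x. indicator A x * f x \<partial>M) \<le> ennreal c * emeasure M A"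
  shows "AE x in M. nn_cond_exp M F f x \<le> ennreal c"
proof -
  define g where "g = nn_cond_exp M F f"
  have [measurable]: "g \<in> borel_measurable F" "g \<in> borel_measurable M" by (auto simp: g_def)
  define A where "A = {x \<in> space F. ennreal c < g x}"
  have A: "A \<in> sets F" unfolding A_def by measurable
  then have AM[measurable]: "A \<in> sets M" using subalg by (auto simp: subalgebra_def)
  have "(\<integral>\<^sup>+x. indicator A x * (g x - ennreal c) \<partial>M)
      = (\<integral>\<^sup>+x. indicator A x * g x - indicator A x * ennreal c \<partial>M)"
    by (intro nn_integral_cong) (auto simp: indicator_def)
  also have "\<dots> = (\<integral>\<^sup>+x. indicator A x * g x \<partial>M) - (\<integral>\<^sup>+x. indicator A x * ennreal c \<partial>M)"
  proof (rule nn_integral_diff)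
    show "(\<integral>\<^sup>+x. indicator A x * ennreal c \<partial>M) \<noteq> \<infinity>"
      by (simp add: nn_integral_multc ennreal_mult_eq_top_iff)
    show "AE x in M. indicator A x * ennreal c \<le> indicator A x * g x"
      by (auto simp: A_def indicator_def)
  qed auto
  also have "(\<integral>\<^sup>+x. indicator A x * g x \<partial>M) = (\<integral>\<^sup>+x. indicator A x * f x \<partial>M)"
    unfolding g_def using A by (intro nn_cond_exp_intg) auto
  also have "\<dots> - (\<integral>\<^sup>+x. indicator A x * ennreal c \<partial>M) = 0"
  proof -
    have c: "(\<integral>\<^sup>+x. indicator A x * ennreal c \<partial>M) = ennreal c * emeasure M A"
      by (subst mult.commute) (rule nn_integral_cmult_indicator[OF AM])
    moreover have "ennreal c * emeasure M A \<noteq> \<top>"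
      by (simp add: ennreal_mult_eq_top_iff)
    ultimately show ?thesis
      using le[OF A] by (subst diff_eq_0_iff_ennreal) (auto intro: le_less_trans simp: less_top)
  qed
  finally have "AE x in M. indicator A x * (g x - ennreal c) = 0"
    by (subst (asm) nn_integral_0_iff_AE) auto
  moreover have "space F = space M" using subalg by (simp add: subalgebra_def)
  ultimately have "AE x in M. g x \<le> ennreal c"
    by (auto elim!: eventually_mono simp: A_def indicator_def diff_eq_0_iff_ennreal split: if_splits)
  then show ?thesis by (simp add: g_def)
qed

section \<open>Moments of a conditionally centred variable\<close>

lemma integrable_powers_of_power4:
  fixes f :: "'a \<Rightarrow> real"
  assumes [measurable]: "f \<in> borel_measurable M" and i: "integrable M (\<lambda>x. (f x)^4)"
  shows "integrable M (\<lambda>x. (f x)\<^sup>2)" "integrable M f"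
proof -
  show 2: "integrable M (\<lambda>x. (f x)\<^sup>2)"
  proof (rule Bochner_Integration.integrable_bound[where f="\<lambda>x. 1 + (f x)^4"])
    show "AE x in M. norm ((f x)\<^sup>2) \<le> norm (1 + (f x)^4)"
    proof (rule AE_I2)
      fix x have "0 \<le> ((f x)\<^sup>2 - 1)\<^sup>2 + (f x)^4 + 1" by simp
      then show "norm ((f x)\<^sup>2) \<le> norm (1 + (f x)^4)"
        by (simp add: power2_eq_square power4_eq_xxxx algebra_simps)
    qed
  qed (use i in auto)
  show "integrable M f"
  proof (rule Bochner_Integration.integrable_bound[where f="\<lambda>x. 1 + (f x)\<^sup>2"])
    show "AE x in M. norm (f x) \<le> norm (1 + (f x)\<^sup>2)"
    proof (rule AE_I2)
      fix x have "0 \<le> (\<bar>f x\<bar> - 1)\<^sup>2 + (f x)^2 + 1" by simp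
      then show "norm (f x) \<le> norm (1 + (f x)\<^sup>2)"
        by (simp add: power2_eq_square algebra_simps)
    qed
  qed (use 2 in auto)
qed

text \<open>In the application \<open>f\<close> is \<phi>(Z) and \<open>g\<close> a version of its
  conditional mean given W. Centring does not increase the conditional second moment, which is at
  most \<open>b\<close>, the root of the bound on the fourth moment. The factor 16 is 8 * (1 + 1),
  because both \<open>f^4\<close> and \<open>g^4\<close> have conditional bound
  \<open>b\<^sup>2\<close>.\<close>

lemma centered_conditional_moments:
  fixes f :: "'a \<Rightarrow> real"
  assumes [measurable]: "f \<in> borel_measurable M" and i4: "integrable M (\<lambda>x. (f x)^4)"
    and le4: "AE x in M. real_cond_exp M F (\<lambda>x. (f x)^4) x \<le> b\<^sup>2" and b: "0 < b"
    and g[measurable]: "g \<in> borel_measurable F" and eq: "AE x in M. g x = real_cond_exp M F f x"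
  shows "integrable M (\<lambda>x. (f x - g x)^4)"
    and "AE x in M. real_cond_exp M F (\<lambda>x. f x - g x) x = 0"
    and "AE x in M. real_cond_exp M F (\<lambda>x. (f x - g x)\<^sup>2) x \<le> b"
    and "AE x in M. real_cond_exp M F (\<lambda>x. (f x - g x)^4) x \<le> 16 * b\<^sup>2"
proof -
  have gM[measurable]: "g \<in> borel_measurable M" using g subalg by (rule measurable_from_subalg[rotated])
  note i2 = integrable_powers_of_power4(1)[OF assms(1) i4]
  note i1 = integrable_powers_of_power4(2)[OF assms(1) i4]
  have c: "integrable M (\<lambda>_. k)" for k :: real by simp
  have cF: "AE x in M. real_cond_exp M F (\<lambda>_. k) x = k" for k :: real
    by (rule real_cond_exp_F_meas) auto
  \<comment> \<open>The second moment is controlled by the fourth through the pointwise inequality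
    coming from \<open>0 \<le> ((f x)\<^sup>2 - b)\<^sup>2\<close>; the weight 1/(2b) makes both
    resulting terms equal to b/2.\<close>
  have le2: "AE x in M. real_cond_exp M F (\<lambda>x. (f x)\<^sup>2) x \<le> b"
  proof -
    have "AE x in M. real_cond_exp M F (\<lambda>x. (f x)\<^sup>2) x \<le> real_cond_exp M F (\<lambda>x. (1/(2*b)) * (f x)^4 + b/2) x"
    proof (rule real_cond_exp_mono)
      show "AE x in M. (f x)\<^sup>2 \<le> (1/(2*b)) * (f x)^4 + b/2"
      proof (rule AE_I2)
        fix x have "0 \<le> ((f x)\<^sup>2 - b)\<^sup>2" by simp
        then show "(f x)\<^sup>2 \<le> (1/(2*b)) * (f x)^4 + b/2"
          using b by (simp add: field_simps power2_eq_square power4_eq_xxxx)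
      qed
    qed (use i2 i4 in auto)
    moreover have "AE x in M. real_cond_exp M F (\<lambda>x. (1/(2*b)) * (f x)^4 + b/2) x =
        real_cond_exp M F (\<lambda>x. (1/(2*b)) * (f x)^4) x + real_cond_exp M F (\<lambda>x. b/2) x"
      using i4 by (intro real_cond_exp_add) auto
    moreover have "AE x in M. real_cond_exp M F (\<lambda>x. (1/(2*b)) * (f x)^4) x = (1/(2*b)) * real_cond_exp M F (\<lambda>x. (f x)^4) x"
      using i4 by (intro real_cond_exp_cmult) auto
    ultimately show ?thesis using le4 cF[of "b/2"]
    proof eventually_elim
      case (elim x)
      have "real_cond_exp M F (\<lambda>x. (f x)\<^sup>2) x \<le> (1/(2*b)) * real_cond_exp M F (\<lambda>x. (f x)^4) x + b/2"
        using elim by linarith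
      also have "\<dots> \<le> (1/(2*b)) * b\<^sup>2 + b/2"
        using elim b by (intro add_right_mono mult_left_mono) auto
      also have "\<dots> = b" using b by (simp add: power2_eq_square)
      finally show ?case .
    qed
  qed
  \<comment> \<open>Jensen's inequality shows that \<open>g\<close> is essentially bounded, whence
    all its powers are integrable.\<close>
  have jensen: "AE x in M. (real_cond_exp M F f x)\<^sup>2 \<le> real_cond_exp M F (\<lambda>x. (f x)\<^sup>2) x"
    using i1 i2 by (intro real_cond_exp_jensens_inequality(2)[where I=UNIV]) (auto intro: convex_power2)
  have g2: "AE x in M. (g x)\<^sup>2 \<le> b"
    using jensen eq le2 by eventually_elim auto
  have g4: "AE x in M. (g x)^4 \<le> b\<^sup>2"
    using g2 
  proof eventually_elim
    case (elim x)
    then have "((g x)\<^sup>2)\<^sup>2 \<le> b\<^sup>2" by (intro power_mono) auto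
    then show ?case by simp
  qed
  have ig: "integrable M (\<lambda>x. (g x)^4)"
    using g4 by (intro integrable_const_bound[where B="b\<^sup>2"]) auto
  note ig2 = integrable_powers_of_power4(1)[OF gM ig] and ig1 = integrable_powers_of_power4(2)[OF gM ig]
  \<comment> \<open>The square of a sum or difference is at most twice the sum of the squares; used
    twice, this gives 2 * 2 * 2 = 8.\<close>
  have pt: "(f x - g x)^4 \<le> 8 * ((f x)^4 + (g x)^4)" for x
  proof -
    have "(f x - g x)\<^sup>2 \<le> 2 * ((f x)\<^sup>2 + (g x)\<^sup>2)"
      using zero_le_power2[of "f x + g x"] by (simp add: power2_eq_square algebra_simps)
    then have "((f x - g x)\<^sup>2)\<^sup>2 \<le> (2 * ((f x)\<^sup>2 + (g x)\<^sup>2))\<^sup>2" by (intro power_mono) auto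
    also have "\<dots> \<le> 8 * ((f x)^4 + (g x)^4)"
      using zero_le_power2[of "(f x)\<^sup>2 - (g x)\<^sup>2"]
      by (simp add: power2_eq_square power4_eq_xxxx algebra_simps)
    finally show ?thesis by simp
  qed
  show i: "integrable M (\<lambda>x. (f x - g x)^4)"
    by (rule Bochner_Integration.integrable_bound[where f="\<lambda>x. 8 * ((f x)^4 + (g x)^4)"])
      (use i4 ig pt in auto)
  have gF: "AE x in M. real_cond_exp M F g x = g x"
    using ig1 by (intro real_cond_exp_F_meas) auto
  show "AE x in M. real_cond_exp M F (\<lambda>x. f x - g x) x = 0"
    using real_cond_exp_diff[OF i1 ig1] gF eq by eventually_elim auto
  have ifg: "integrable M (\<lambda>x. g x * f x)"
  proof (rule Bochner_Integration.integrable_bound[where f="\<lambda>x. (f x)\<^sup>2 + (g x)\<^sup>2"])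
    show "AE x in M. norm (g x * f x) \<le> norm ((f x)\<^sup>2 + (g x)\<^sup>2)"
    proof (rule AE_I2)
      fix x
      have "0 \<le> (\<bar>f x\<bar> - \<bar>g x\<bar>)\<^sup>2 + (f x)\<^sup>2 + (g x)\<^sup>2" by simp
      then show "norm (g x * f x) \<le> norm ((f x)\<^sup>2 + (g x)\<^sup>2)"
        by (simp add: power2_eq_square algebra_simps abs_mult)
    qed
  qed (use i2 ig2 in auto)
  \<comment> \<open>Conditional variance identity: pulling out the F-measurable factor
    \<open>g\<close> leaves the conditional second moment of \<open>f\<close> minus
    \<open>g\<^sup>2\<close>.\<close>
  have "AE x in M. real_cond_exp M F (\<lambda>x. (f x - g x)\<^sup>2) x
      = real_cond_exp M F (\<lambda>x. (f x)\<^sup>2 + ((g x)\<^sup>2 - 2 * (g x * f x))) x"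
    by (rule real_cond_exp_cong) (auto simp: power2_eq_square algebra_simps)
  moreover have "AE x in M. real_cond_exp M F (\<lambda>x. (f x)\<^sup>2 + ((g x)\<^sup>2 - 2 * (g x * f x))) x
     = real_cond_exp M F (\<lambda>x. (f x)\<^sup>2) x + real_cond_exp M F (\<lambda>x. ((g x)\<^sup>2 - 2 * (g x * f x))) x"
    using i2 ig2 ifg by (intro real_cond_exp_add) auto
  moreover have "AE x in M. real_cond_exp M F (\<lambda>x. ((g x)\<^sup>2 - 2 * (g x * f x))) x =
      real_cond_exp M F (\<lambda>x. (g x)\<^sup>2) x - real_cond_exp M F (\<lambda>x. 2 * (g x * f x)) x"
    using ig2 ifg by (intro real_cond_exp_diff) auto
  moreover have "AE x in M. real_cond_exp M F (\<lambda>x. (g x)\<^sup>2) x = (g x)\<^sup>2"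
    using ig2 by (intro real_cond_exp_F_meas) auto
  moreover have "AE x in M. real_cond_exp M F (\<lambda>x. 2 * (g x * f x)) x = 2 * real_cond_exp M F (\<lambda>x. g x * f x) x"
    using ifg by (intro real_cond_exp_cmult) auto
  moreover have "AE x in M. real_cond_exp M F (\<lambda>x. g x * f x) x = g x * real_cond_exp M F f x"
    using ifg by (intro real_cond_exp_mult) auto
  ultimately show "AE x in M. real_cond_exp M F (\<lambda>x. (f x - g x)\<^sup>2) x \<le> b"
    using eq le2
  proof eventually_elim
    case (elim x)
    then have "real_cond_exp M F (\<lambda>x. (f x - g x)\<^sup>2) x = real_cond_exp M F (\<lambda>x. (f x)\<^sup>2) x - (g x)\<^sup>2"
      by (simp add: power2_eq_square)
    with elim(8) show ?case using zero_le_power2[of "g x"] by linarith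
  qed
  have "AE x in M. real_cond_exp M F (\<lambda>x. (f x - g x)^4) x \<le> real_cond_exp M F (\<lambda>x. 8 * ((f x)^4 + (g x)^4)) x"
    using i i4 ig pt by (intro real_cond_exp_mono) auto
  moreover have "AE x in M. real_cond_exp M F (\<lambda>x. 8 * ((f x)^4 + (g x)^4)) x
      = 8 * real_cond_exp M F (\<lambda>x. (f x)^4 + (g x)^4) x"
    using i4 ig by (intro real_cond_exp_cmult) auto
  moreover have "AE x in M. real_cond_exp M F (\<lambda>x. (f x)^4 + (g x)^4) x
      = real_cond_exp M F (\<lambda>x. (f x)^4) x + real_cond_exp M F (\<lambda>x. (g x)^4) x"
    using i4 ig by (intro real_cond_exp_add) auto
  moreover have "AE x in M. real_cond_exp M F (\<lambda>x. (g x)^4) x = (g x)^4"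
    using ig by (intro real_cond_exp_F_meas) auto
  ultimately show "AE x in M. real_cond_exp M F (\<lambda>x. (f x - g x)^4) x \<le> 16 * b\<^sup>2"
    using le4 g4 by eventually_elim linarith
qed

end

subsection \<open>Distinguishing two product measures\<close>

text \<open>It suffices to compare both measures on boxes, whose indicators factorise, so that the
  integral splits into one-dimensional integrals.\<close>

lemma PiM_density:
  assumes I: "finite I" and M: "sigma_finite_measure M" and D: "sigma_finite_measure (density M p)"
    and [measurable]: "p \<in> borel_measurable M"
  shows "PiM I (\<lambda>_. density M p) = density (PiM I (\<lambda>_. M)) (\<lambda>x. \<Prod>i\<in>I. p (x i))"
proof -
  interpret D: product_sigma_finite "\<lambda>_. density M p"
    using D by (simp add: product_sigma_finite_def)
  interpret M: product_sigma_finite "\<lambda>_. M"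
    using M by (simp add: product_sigma_finite_def)
  show ?thesis
  proof (rule D.PiM_eqI[symmetric, OF I])
    show "sets (density (PiM I (\<lambda>_. M)) (\<lambda>x. \<Prod>i\<in>I. p (x i))) = sets (PiM I (\<lambda>_. density M p))"
      by (simp cong: sets_PiM_cong)
    fix A assume A: "\<And>i. i \<in> I \<Longrightarrow> A i \<in> sets (density M p)"
    then have [measurable]: "\<And>i. i \<in> I \<Longrightarrow> A i \<in> sets M" by simp
    have "emeasure (density (PiM I (\<lambda>_. M)) (\<lambda>x. \<Prod>i\<in>I. p (x i))) (Pi\<^sub>E I A)
        = (\<integral>\<^sup>+x. (\<Prod>i\<in>I. p (x i)) * indicator (Pi\<^sub>E I A) x \<partial>PiM I (\<lambda>_. M))"
      using I A by (subst emeasure_density) (auto intro!: sets_PiM_I_finite)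
    also have "\<dots> = (\<integral>\<^sup>+x. (\<Prod>i\<in>I. p (x i) * indicator (A i) (x i)) \<partial>PiM I (\<lambda>_. M))"
    proof (rule nn_integral_cong)
      fix x assume x: "x \<in> space (PiM I (\<lambda>_. M))"
      have "indicator (Pi\<^sub>E I A) x = (\<Prod>i\<in>I. indicator (A i) (x i) :: ennreal)"
      proof (cases "x \<in> Pi\<^sub>E I A")
        case True
        then show ?thesis by (simp add: PiE_iff)
      next
        case False
        then obtain i where "i \<in> I" "x i \<notin> A i" using x by (auto simp: space_PiM PiE_iff)
        then have "(\<Prod>i\<in>I. indicator (A i) (x i) :: ennreal) = 0"
          using I by (intro prod_zero) (auto intro!: bexI[of _ i])
        then show ?thesis using False by simp
      qed
      then show "(\<Prod>i\<in>I. p (x i)) * indicator (Pi\<^sub>E I A) x = (\<Prod>i\<in>I. p (x i) * indicator (A i) (x i))"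
        by (simp add: prod.distrib)
    qed
    also have "\<dots> = (\<Prod>i\<in>I. \<integral>\<^sup>+y. p y * indicator (A i) y \<partial>M)"
      using I by (intro M.product_nn_integral_prod[of I "\<lambda>i y. p y * indicator (A i) y"]) auto
    also have "\<dots> = (\<Prod>i\<in>I. emeasure (density M p) (A i))"
      by (intro prod.cong refl) (auto simp: emeasure_density)
    finally show "emeasure (density (PiM I (\<lambda>_. M)) (\<lambda>x. \<Prod>i\<in>I. p (x i))) (Pi\<^sub>E I A)
       = (\<Prod>i\<in>I. emeasure (density M p) (A i))" .
  qed
qed

text \<open>With \<open>a = sqrt p\<close> and \<open>b = sqrt q\<close>, the difference of the two
  sides is the sum of the squares of \<open>a * (x - L) + b * L\<close> and
  \<open>b * (x + L) - a * L\<close>.\<close>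

lemma two_point_pointwise:
  fixes p q :: real
  assumes "0 \<le> p" "0 \<le> q"
  shows "4 * L\<^sup>2 * sqrt (p * q) \<le> p * (x - L)\<^sup>2 + q * (x + L)\<^sup>2 + L\<^sup>2 * (p + q)"
proof -
  define a b where "a = sqrt p" and "b = sqrt q"
  have ab: "p = a\<^sup>2" "q = b\<^sup>2" "sqrt (p * q) = a * b" "0 \<le> a * b"
    using assms by (auto simp: a_def b_def real_sqrt_mult)
  have "0 \<le> (a * (x - L) + b * L)\<^sup>2 + (b * (x + L) - a * L)\<^sup>2"
    by simp
  also have "\<dots> = p * (x - L)\<^sup>2 + q * (x + L)\<^sup>2 + L\<^sup>2 * (p + q) - 4 * L\<^sup>2 * (a * b)"
    by (simp add: ab power2_eq_square algebra_simps)
  finally show ?thesis by (simp add: ab(3))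
qed

text \<open>The pointwise inequality integrated with the joint densities of the samples in the roles
  of \<open>p\<close> and \<open>q\<close>. The left side contains the Hellinger affinity, a power
  because it is multiplicative over independent coordinates; the last term comes from the two
  densities having mass 1. The additive form also covers infinite risks.\<close>

lemma two_point_risk:
  fixes p q :: "'a \<Rightarrow> real" and l :: "(nat \<Rightarrow> 'a) \<Rightarrow> real"
  assumes I: "finite I" and M: "prob_space M"
    and [measurable]: "p \<in> borel_measurable M" "q \<in> borel_measurable M"
    and nonneg: "\<And>x. 0 \<le> p x" "\<And>x. 0 \<le> q x"
    and P: "prob_space (density M (\<lambda>x. ennreal (p x)))" and Q: "prob_space (density M (\<lambda>x. ennreal (q x)))"
    and [measurable]: "l \<in> borel_measurable (PiM I (\<lambda>_. M))"
  shows "ennreal (4 * L\<^sup>2) * (\<integral>\<^sup>+x. ennreal (sqrt (p x * q x)) \<partial>M) ^ card I \<le>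
    (\<integral>\<^sup>+x. ennreal ((l x - L)\<^sup>2) \<partial>PiM I (\<lambda>_. density M (\<lambda>x. ennreal (p x)))) +
    (\<integral>\<^sup>+x. ennreal ((l x + L)\<^sup>2) \<partial>PiM I (\<lambda>_. density M (\<lambda>x. ennreal (q x)))) + ennreal (2 * L\<^sup>2)"
proof -
  interpret M: prob_space M by fact
  interpret Mp: product_sigma_finite "\<lambda>_::nat. M" ..
  define N where "N = PiM I (\<lambda>_::nat. M)"
  define f where "f r x = (\<Prod>i\<in>I. r (x i))" for r :: "'a \<Rightarrow> real" and x
  have [measurable]: "f r \<in> borel_measurable N" if "r \<in> borel_measurable M" for r
    using that unfolding f_def N_def by measurable
  have [measurable]: "l \<in> borel_measurable N" by (simp add: N_def)
  have fnn: "0 \<le> f r x" if "\<And>x. 0 \<le> r x" for r x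
    using that by (auto simp: f_def intro: prod_nonneg)
  \<comment> \<open>\<open>f r\<close> is the joint density of the sample relative to the product
    measure \<open>N\<close>.\<close>
  have dens: "PiM I (\<lambda>_. density M (\<lambda>x. ennreal (r x))) = density N (\<lambda>x. ennreal (f r x))"
    and one: "(\<integral>\<^sup>+x. ennreal (f r x) \<partial>N) = 1"
    if "prob_space (density M (\<lambda>x. ennreal (r x)))" "\<And>x. 0 \<le> r x" and [measurable]: "r \<in> borel_measurable M" for r
  proof -
    interpret R: prob_space "density M (\<lambda>x. ennreal (r x))" by fact
    show *: "PiM I (\<lambda>_. density M (\<lambda>x. ennreal (r x))) = density N (\<lambda>x. ennreal (f r x))"
      unfolding N_def f_def using that I
      by (subst PiM_density) (auto simp: prod_ennreal intro: M.sigma_finite_measure_axioms R.sigma_finite_measure_axioms)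
    interpret RP: prob_space "PiM I (\<lambda>_. density M (\<lambda>x. ennreal (r x)))"
      by (rule prob_space_PiM) (rule that(1))
    show "(\<integral>\<^sup>+x. ennreal (f r x) \<partial>N) = 1"
      using RP.emeasure_space_1 unfolding * by (simp add: emeasure_density nn_integral_indicator cong: nn_integral_cong)
  qed
  have H: "(\<integral>\<^sup>+x. ennreal (sqrt (f p x * f q x)) \<partial>N) = (\<integral>\<^sup>+x. ennreal (sqrt (p x * q x)) \<partial>M) ^ card I"
  proof -
    have "ennreal (sqrt (f p x * f q x)) = (\<Prod>i\<in>I. ennreal (sqrt (p (x i) * q (x i))))" for x
    proof -
      have "sqrt (f p x * f q x) = (\<Prod>i\<in>I. sqrt (p (x i) * q (x i)))"
        unfolding f_def prod.distrib[symmetric] using I by (induction I) (auto simp: real_sqrt_mult)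
      then show ?thesis
        using nonneg by (simp only:) (rule prod_ennreal[symmetric], simp)
    qed
    then have "(\<integral>\<^sup>+x. ennreal (sqrt (f p x * f q x)) \<partial>N) = (\<integral>\<^sup>+x. (\<Prod>i\<in>I. ennreal (sqrt (p (x i) * q (x i)))) \<partial>N)"
      by simp
    also have "\<dots> = (\<Prod>i\<in>I. \<integral>\<^sup>+x. ennreal (sqrt (p x * q x)) \<partial>M)"
      unfolding N_def using I by (intro Mp.product_nn_integral_prod) auto
    finally show ?thesis by simp
  qed
  have "ennreal (4 * L\<^sup>2) * (\<integral>\<^sup>+x. ennreal (sqrt (p x * q x)) \<partial>M) ^ card I
      = (\<integral>\<^sup>+x. ennreal (4 * L\<^sup>2 * sqrt (f p x * f q x)) \<partial>N)"
  proof -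
    have "ennreal (4 * L\<^sup>2 * sqrt (f p x * f q x)) = ennreal (4 * L\<^sup>2) * ennreal (sqrt (f p x * f q x))" for x
      using fnn[OF nonneg(1)] fnn[OF nonneg(2)] by (intro ennreal_mult) auto
    then show ?thesis
      unfolding H[symmetric] by (simp only: nn_integral_cmult[symmetric]) (subst nn_integral_cmult, auto)
  qed
  also have "\<dots> \<le> (\<integral>\<^sup>+x. ennreal (f p x) * ennreal ((l x - L)\<^sup>2) + ennreal (f q x) * ennreal ((l x + L)\<^sup>2)
      + ennreal (L\<^sup>2) * (ennreal (f p x) + ennreal (f q x)) \<partial>N)"
  proof (rule nn_integral_mono)
    fix x
    have "0 \<le> f p x" "0 \<le> f q x" using fnn nonneg by auto
    then show "ennreal (4 * L\<^sup>2 * sqrt (f p x * f q x)) \<le>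
        ennreal (f p x) * ennreal ((l x - L)\<^sup>2) + ennreal (f q x) * ennreal ((l x + L)\<^sup>2)
        + ennreal (L\<^sup>2) * (ennreal (f p x) + ennreal (f q x))"
      using two_point_pointwise[of "f p x" "f q x" L "l x"]
      by (simp add: ennreal_mult[symmetric] ennreal_plus[symmetric] ennreal_leI del: ennreal_plus)
  qed
  also have "\<dots> = (\<integral>\<^sup>+x. ennreal (f p x) * ennreal ((l x - L)\<^sup>2) \<partial>N) + (\<integral>\<^sup>+x. ennreal (f q x) * ennreal ((l x + L)\<^sup>2) \<partial>N)
      + ennreal (L\<^sup>2) * ((\<integral>\<^sup>+x. ennreal (f p x) \<partial>N) + (\<integral>\<^sup>+x. ennreal (f q x) \<partial>N))"
    by (simp add: nn_integral_add nn_integral_cmult)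
  also have "\<dots> = (\<integral>\<^sup>+x. ennreal (f p x) * ennreal ((l x - L)\<^sup>2) \<partial>N) + (\<integral>\<^sup>+x. ennreal (f q x) * ennreal ((l x + L)\<^sup>2) \<partial>N)
      + ennreal (2 * L\<^sup>2)"
  proof -
    have "ennreal (2 * L\<^sup>2) = ennreal (L\<^sup>2) * (1 + 1)"
      by (simp add: ennreal_mult mult.commute)
    then show ?thesis using one[OF P nonneg(1)] one[OF Q nonneg(2)] by simp
  qed
  finally show ?thesis
    using dens[OF P nonneg(1)] dens[OF Q nonneg(2)] by (simp add: nn_integral_density)
qed

subsection \<open>Gaussian noise and endogenous errors\<close>

abbreviation std_gaussian :: "real measure" where
  "std_gaussian \<equiv> density lborel (\<lambda>x. ennreal (std_normal_density x))"

lemma prob_space_std_gaussian: "prob_space std_gaussian"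
  by (rule prob_space_normal_density) simp

text \<open>Cameron-Martin formula: exp(a y - a^2/2) is the density of the normal law with mean
  \<open>a\<close> relative to the standard one. The proof substitutes y = a + v.\<close>

lemma nn_integral_std_gaussian_shift:
  assumes [measurable]: "f \<in> borel_measurable borel"
  shows "(\<integral>\<^sup>+v. f (v + a) \<partial>std_gaussian) = (\<integral>\<^sup>+y. ennreal (exp (a * y - a\<^sup>2 / 2)) * f y \<partial>std_gaussian)"
proof -
  have "(\<integral>\<^sup>+y. ennreal (exp (a * y - a\<^sup>2 / 2)) * f y \<partial>std_gaussian)
      = (\<integral>\<^sup>+y. ennreal (std_normal_density y) * (ennreal (exp (a * y - a\<^sup>2 / 2)) * f y) \<partial>lborel)"
    by (subst nn_integral_density) auto
  also have "\<dots> = (\<integral>\<^sup>+v. ennreal (std_normal_density (a + 1 * v)) *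
      (ennreal (exp (a * (a + 1 * v) - a\<^sup>2 / 2)) * f (a + 1 * v)) \<partial>lborel)"
    by (subst nn_integral_real_affine[where c=1 and t=a]) auto
  also have "\<dots> = (\<integral>\<^sup>+v. ennreal (std_normal_density v) * f (v + a) \<partial>lborel)"
  proof (intro nn_integral_cong)
    fix v
    have "std_normal_density (a + 1 * v) * exp (a * (a + 1 * v) - a\<^sup>2 / 2) = std_normal_density v"
      by (simp add: std_normal_density_def exp_add[symmetric] power2_eq_square field_simps)
    then show "ennreal (std_normal_density (a + 1 * v)) * (ennreal (exp (a * (a + 1 * v) - a\<^sup>2 / 2)) * f (a + 1 * v))
        = ennreal (std_normal_density v) * f (v + a)"
      by (simp add: mult.assoc[symmetric] ennreal_mult[symmetric] add.commute)
  qed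
  also have "\<dots> = (\<integral>\<^sup>+v. f (v + a) \<partial>std_gaussian)"
    by (subst nn_integral_density) auto
  finally show ?thesis by simp
qed

lemma std_gaussian_mean: "has_bochner_integral std_gaussian (\<lambda>v. v) 0"
  using std_normal_moment_odd[of 0] by (subst has_bochner_integral_density) auto

text \<open>Binomial expansion with the normal moments 1, 0, 1, 0, 3. In the application
  \<open>a\<close> is \<phi>(Z) - \<mu>(W), so this is the fourth moment of the error given (Z,
  W).\<close>

lemma nn_integral_std_gaussian_power4:
  "(\<integral>\<^sup>+v. ennreal ((v - a)^4) \<partial>std_gaussian) = ennreal (3 + 6 * a\<^sup>2 + a^4)"
proof -
  have m0: "has_bochner_integral lborel (\<lambda>x. std_normal_density x) 1"
    and m1: "has_bochner_integral lborel (\<lambda>x. std_normal_density x * x) 0"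
    and m2: "has_bochner_integral lborel (\<lambda>x. std_normal_density x * x^2) 1"
    and m3: "has_bochner_integral lborel (\<lambda>x. std_normal_density x * x^3) 0"
    and m4: "has_bochner_integral lborel (\<lambda>x. std_normal_density x * x^4) 3"
    using std_normal_moment_even[of 0] std_normal_moment_odd[of 0] std_normal_moment_even[of 1]
      std_normal_moment_odd[of 1] std_normal_moment_even[of 2]
    by (simp_all add: fact_numeral)
  have "has_bochner_integral lborel (\<lambda>x. std_normal_density x * x^4 - (4 * a) * (std_normal_density x * x^3)
      + (6 * a\<^sup>2) * (std_normal_density x * x^2) - (4 * a^3) * (std_normal_density x * x) + a^4 * std_normal_density x)
      (3 - (4 * a) * 0 + (6 * a\<^sup>2) * 1 - (4 * a^3) * 0 + a^4 * 1)"
    by (intro has_bochner_integral_add has_bochner_integral_diff has_bochner_integral_mult_right m0 m1 m2 m3 m4)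
  then have "has_bochner_integral lborel (\<lambda>x. std_normal_density x * (x - a)^4) (3 + 6 * a\<^sup>2 + a^4)"
    by (simp add: power4_eq_xxxx power2_eq_square power3_eq_cube algebra_simps)
  then have "(\<integral>\<^sup>+x. ennreal (std_normal_density x * (x - a)^4) \<partial>lborel) = ennreal (3 + 6 * a\<^sup>2 + a^4)"
    by (subst nn_integral_eq_integral) (auto simp: has_bochner_integral_iff intro!: AE_I2)
  then show ?thesis
    by (subst nn_integral_density) (auto simp: ennreal_mult)
qed

section \<open>Sigma-algebras generated by a random variable\<close>

lemma sets_sigma_of:
  assumes "X \<in> measurable M N"
  shows "sets (sigma_of M X N) = {X -` B \<inter> space M | B. B \<in> sets N}"
  using measurable_space[OF assms] unfolding sigma_of_def by (intro sets_vimage_algebra2) blast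

lemma subalgebra_sigma_of:
  assumes "X \<in> measurable M N"
  shows "subalgebra M (sigma_of M X N)"
  unfolding subalgebra_def sets_sigma_of[OF assms]
  using measurable_sets[OF assms] by (auto simp: sigma_of_def)

lemma measurable_sigma_of [measurable (raw)]:
  assumes "X \<in> measurable M N" "f \<in> measurable N L"
  shows "(\<lambda>x. f (X x)) \<in> measurable (sigma_of M X N) L"
proof -
  have "X \<in> measurable (sigma_of M X N) N"
    unfolding sigma_of_def using measurable_space[OF assms(1)] by (intro measurable_vimage_algebra1) blast
  then show ?thesis using assms(2) by (rule measurable_compose)
qed

section \<open>The law of the endogenous error\<close>

text \<open>The Gaussian factor is the noise V, independent of (Z, W). The function
  \<open>\<mu>\<close> will be a version of the conditional mean of \<phi>(Z) given W; that property
  enters when the conditional moments of the error are computed.\<close>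

definition error_law ::
  "'z measure \<Rightarrow> 'w measure \<Rightarrow> ('z \<times> 'w) measure \<Rightarrow> ('z \<Rightarrow> real) \<Rightarrow> ('w \<Rightarrow> real) \<Rightarrow> (real \<times> 'z \<times> 'w) measure" where
  "error_law PZ PW Q \<phi> \<mu> =
     distr (std_gaussian \<Otimes>\<^sub>M Q) (obs_algebra PZ PW)
       (\<lambda>x. (fst x - (\<phi> (fst (snd x)) - \<mu> (snd (snd x))), snd x))"

context
  fixes PZ :: "'z measure" and PW :: "'w measure" and Q :: "('z \<times> 'w) measure"
    and \<phi> :: "'z \<Rightarrow> real" and \<mu> :: "'w \<Rightarrow> real"
  assumes Q: "prob_space Q" and sets_Q: "sets Q = sets (PZ \<Otimes>\<^sub>M PW)"
    and meas [measurable]: "\<phi> \<in> borel_measurable PZ" "\<mu> \<in> borel_measurable PW"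
begin

interpretation Q: prob_space Q by (rule Q)
interpretation G: prob_space std_gaussian by (rule prob_space_std_gaussian)
interpretation GQ: pair_prob_space std_gaussian Q ..

lemmas [measurable_cong] = sets_Q

lemma sets_std_gaussian_pair: "sets (std_gaussian \<Otimes>\<^sub>M Q) = sets (obs_algebra PZ PW)"
  unfolding obs_algebra_def by (intro sets_pair_measure_cong) (auto simp: sets_Q)

lemma measurable_subtract_error:
  "(\<lambda>x. (fst x - (\<phi> (fst (snd x)) - \<mu> (snd (snd x))), snd x)) \<in> measurable (std_gaussian \<Otimes>\<^sub>M Q) (obs_algebra PZ PW)"
  unfolding measurable_cong_sets[OF sets_std_gaussian_pair refl] unfolding obs_algebra_def by measurable

text \<open>In Y = \<phi>(Z) + U the term \<phi>(Z) cancels and Y = V + \<mu>(W) remains. Given (Z,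
  W) this is a shifted Gaussian, and the Cameron-Martin factor is its density. The dominating
  measure is free of \<open>\<phi>\<close> and \<open>\<mu>\<close>, so it serves both hypotheses at
  once.\<close>

lemma model_law_error_law:
  "model_law PZ PW (error_law PZ PW Q \<phi> \<mu>) \<phi> =
     density (std_gaussian \<Otimes>\<^sub>M Q) (\<lambda>x. ennreal (exp (\<mu> (snd (snd x)) * fst x - (\<mu> (snd (snd x)))\<^sup>2 / 2)))"
    (is "?L = ?R")
proof -
  have L: "?L = distr (std_gaussian \<Otimes>\<^sub>M Q) (obs_algebra PZ PW) (\<lambda>x. (fst x + \<mu> (snd (snd x)), snd x))"
    unfolding model_law_def error_law_def
    using measurable_subtract_error
    by (subst distr_distr) (auto simp: obs_algebra_def comp_def split_beta intro!: distr_cong)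
  show ?thesis
  proof (rule measure_eqI)
    show "sets ?L = sets ?R" using sets_std_gaussian_pair by (simp add: L)
    fix A assume "A \<in> sets ?L"
    then have A[measurable]: "A \<in> sets (obs_algebra PZ PW)" by (simp add: L)
    have A': "A \<in> sets (std_gaussian \<Otimes>\<^sub>M Q)" using A by (simp only: sets_std_gaussian_pair)
    have A'': "A \<in> sets (borel \<Otimes>\<^sub>M (PZ \<Otimes>\<^sub>M PW))" using A by (simp add: obs_algebra_def)
    have "emeasure ?L A = (\<integral>\<^sup>+x. indicator A x \<partial>?L)" using A by (simp add: L)
    also have "\<dots> = (\<integral>\<^sup>+x. indicator A (fst x + \<mu> (snd (snd x)), snd x) \<partial>(std_gaussian \<Otimes>\<^sub>M Q))"
      unfolding L using A'' by (subst nn_integral_distr) (auto simp: obs_algebra_def)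
    also have "\<dots> = (\<integral>\<^sup>+y. \<integral>\<^sup>+v. indicator A (v + \<mu> (snd y), y) \<partial>std_gaussian \<partial>Q)"
      using A'' by (subst GQ.nn_integral_snd[symmetric]) auto
    also have "\<dots> = (\<integral>\<^sup>+y. \<integral>\<^sup>+v. ennreal (exp (\<mu> (snd y) * v - (\<mu> (snd y))\<^sup>2 / 2)) * indicator A (v, y) \<partial>std_gaussian \<partial>Q)"
    proof (rule nn_integral_cong)
      fix y assume [measurable]: "y \<in> space Q"
      then have "y \<in> space (PZ \<Otimes>\<^sub>M PW)" by (simp add: sets_Q[THEN sets_eq_imp_space_eq])
      then show "(\<integral>\<^sup>+v. indicator A (v + \<mu> (snd y), y) \<partial>std_gaussian) =
         (\<integral>\<^sup>+v. ennreal (exp (\<mu> (snd y) * v - (\<mu> (snd y))\<^sup>2 / 2)) * indicator A (v, y) \<partial>std_gaussian)"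
        using A'' by (intro nn_integral_std_gaussian_shift) auto
    qed
    also have "\<dots> = (\<integral>\<^sup>+x. ennreal (exp (\<mu> (snd (snd x)) * fst x - (\<mu> (snd (snd x)))\<^sup>2 / 2)) * indicator A x \<partial>(std_gaussian \<Otimes>\<^sub>M Q))"
      using A'' by (subst GQ.nn_integral_snd[symmetric]) auto
    also have "\<dots> = emeasure ?R A"
      using A' by (subst emeasure_density) auto
    finally show "emeasure ?L A = emeasure ?R A" .
  qed
qed

lemma prob_space_error_law: "prob_space (error_law PZ PW Q \<phi> \<mu>)"
  unfolding error_law_def by (rule GQ.prob_space_distr) (rule measurable_subtract_error)

lemma sets_error_law: "sets (error_law PZ PW Q \<phi> \<mu>) = sets (obs_algebra PZ PW)"
  by (simp add: error_law_def)

lemma distr_error_law_snd: "distr (error_law PZ PW Q \<phi> \<mu>) (PZ \<Otimes>\<^sub>M PW) snd = Q"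
proof -
  have "distr (error_law PZ PW Q \<phi> \<mu>) (PZ \<Otimes>\<^sub>M PW) snd = distr (std_gaussian \<Otimes>\<^sub>M Q) Q snd"
    unfolding error_law_def
    using measurable_subtract_error
    by (subst distr_distr) (auto simp: obs_algebra_def comp_def split_beta sets_Q intro!: distr_cong)
  also have "\<dots> = Q"
  proof (rule measure_eqI)
    fix A assume "A \<in> sets (distr (std_gaussian \<Otimes>\<^sub>M Q) Q snd)"
    then have A: "A \<in> sets Q" by simp
    have "snd -` A \<inter> space (std_gaussian \<Otimes>\<^sub>M Q) = space std_gaussian \<times> A"
      using sets.sets_into_space[OF A] by (auto simp: space_pair_measure)
    then show "emeasure (distr (std_gaussian \<Otimes>\<^sub>M Q) Q snd) A = emeasure Q A"
      using A by (simp add: emeasure_distr Q.emeasure_pair_measure_Times G.emeasure_space_1[simplified])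
  qed simp
  finally show ?thesis .
qed

text \<open>The error is V - D with D = \<phi>(Z) - \<mu>(W). Here V is independent of (Z, W), and D
  has conditional mean 0, second moment at most \<open>b\<close> and fourth moment at most
  \<open>16 * b\<^sup>2\<close> given W. The Gaussian fourth moment 3 + 6 D^2 + D^4 then yields the
  bound in the last hypothesis.\<close>

lemma error_law_in_U_class:
  assumes i4: "integrable Q (\<lambda>x. (\<phi> (fst x))^4)"
    and le4: "AE x in Q. real_cond_exp Q (sigma_of Q snd PW) (\<lambda>x. (\<phi> (fst x))^4) x \<le> b\<^sup>2"
    and b: "0 < b"
    and eq: "AE x in Q. \<mu> (snd x) = real_cond_exp Q (sigma_of Q snd PW) (\<lambda>x. \<phi> (fst x)) x"
    and \<sigma>: "3 + 6 * b + 16 * b\<^sup>2 \<le> \<sigma>^4"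
  shows "error_law PZ PW Q \<phi> \<mu> \<in> U_class PW \<sigma>"
proof -
  let ?M = "error_law PZ PW Q \<phi> \<mu>"
  let ?F = "sigma_of Q snd PW"
  let ?D = "\<lambda>x. \<phi> (fst x) - \<mu> (snd x)"
  define FM where "FM = sigma_of ?M (\<lambda>x. snd (snd x)) PW"
  have [measurable]: "snd \<in> measurable Q PW" by measurable
  interpret QF: finite_measure_subalgebra Q ?F
    by unfold_locales (rule subalgebra_sigma_of, measurable)
  note mom = QF.centered_conditional_moments[of "\<lambda>x. \<phi> (fst x)" b "\<lambda>x. \<mu> (snd x)", OF _ i4 le4 b _ eq, simplified]
  have D4: "integrable Q (\<lambda>x. (?D x)^4)" by (rule mom) measurable
  have Dm[measurable]: "?D \<in> borel_measurable Q" by measurable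
  note D2 = QF.integrable_powers_of_power4(1)[OF Dm D4]
  note D1 = QF.integrable_powers_of_power4(2)[OF Dm D4]
  interpret M: prob_space ?M by (rule prob_space_error_law)
  note [measurable_cong] = sets_error_law
  have sM[measurable]: "(\<lambda>x. snd (snd x)) \<in> measurable ?M PW" "fst \<in> borel_measurable ?M" 
    by (auto simp: measurable_cong_sets[OF sets_error_law refl] obs_algebra_def)
  interpret MF: finite_measure_subalgebra ?M FM
    unfolding FM_def by unfold_locales (rule subalgebra_sigma_of, rule sM)
  \<comment> \<open>Fubini with the noise integrated first: for fixed (z, w) the error is a standard
    normal variable shifted by a constant.\<close>
  have tr: "(\<integral>\<^sup>+x. f x \<partial>?M) = (\<integral>\<^sup>+y. \<integral>\<^sup>+v. f (v - ?D y, y) \<partial>std_gaussian \<partial>Q)"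
    if "f \<in> borel_measurable (obs_algebra PZ PW)" for f :: "_ \<Rightarrow> ennreal"
  proof -
    have [measurable]: "f \<in> borel_measurable (borel \<Otimes>\<^sub>M (PZ \<Otimes>\<^sub>M PW))" using that by (simp add: obs_algebra_def)
    have "(\<integral>\<^sup>+x. f x \<partial>?M) = (\<integral>\<^sup>+x. f (fst x - ?D (snd x), snd x) \<partial>(std_gaussian \<Otimes>\<^sub>M Q))"
      unfolding error_law_def by (subst nn_integral_distr[OF measurable_subtract_error]) (use that in simp_all)
    also have "\<dots> = (\<integral>\<^sup>+y. \<integral>\<^sup>+v. f (v - ?D y, y) \<partial>std_gaussian \<partial>Q)"
      by (subst GQ.nn_integral_snd[symmetric]) auto
    finally show ?thesis .
  qed
  \<comment> \<open>The fourth moment is integrated over an event that depends on W only, which is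
    what the conditional bounds on D require.\<close>
  have fourth: "(\<integral>\<^sup>+x. indicator (snd -` B \<inter> space Q) (snd x) * ennreal ((fst x)^4) \<partial>?M)
      \<le> ennreal (\<sigma>^4) * emeasure Q (snd -` B \<inter> space Q)" if B: "B \<in> sets PW" for B
  proof -
    let ?C = "snd -` B \<inter> space Q"
    have C: "?C \<in> sets ?F" using B by (subst sets_sigma_of) auto
    have CQ[measurable]: "?C \<in> sets Q" using B by measurable
    have CP[measurable]: "?C \<in> sets (PZ \<Otimes>\<^sub>M PW)" using CQ by (simp add: sets_Q)
    have "(\<integral>\<^sup>+x. indicator ?C (snd x) * ennreal ((fst x)^4) \<partial>?M)
      = (\<integral>\<^sup>+y. \<integral>\<^sup>+v. indicator ?C y * ennreal ((v - ?D y)^4) \<partial>std_gaussian \<partial>Q)"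
      by (subst tr) (auto simp: obs_algebra_def)
    also have "\<dots> = (\<integral>\<^sup>+y. indicator ?C y * ennreal (3 + 6 * (?D y)\<^sup>2 + (?D y)^4) \<partial>Q)"
      by (subst nn_integral_cmult) (auto simp: nn_integral_std_gaussian_power4)
    also have "\<dots> = (\<integral>\<^sup>+y. ennreal (3 * indicator ?C y + 6 * (indicator ?C y * (?D y)\<^sup>2) + indicator ?C y * (?D y)^4) \<partial>Q)"
      by (intro nn_integral_cong) (auto simp: indicator_def)
    also have "\<dots> = ennreal (\<integral>y. 3 * indicator ?C y + 6 * (indicator ?C y * (?D y)\<^sup>2) + indicator ?C y * (?D y)^4 \<partial>Q)"
      using integrable_mult_indicator[OF CQ D2] integrable_mult_indicator[OF CQ D4]
      by (intro nn_integral_eq_integral) (auto simp: less_top[symmetric])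
    also have "(\<integral>y. 3 * indicator ?C y + 6 * (indicator ?C y * (?D y)\<^sup>2) + indicator ?C y * (?D y)^4 \<partial>Q)
       = 3 * measure Q ?C + 6 * (\<integral>y. indicator ?C y * (?D y)\<^sup>2 \<partial>Q) + (\<integral>y. indicator ?C y * (?D y)^4 \<partial>Q)"
      using integrable_mult_indicator[OF CQ D2] integrable_mult_indicator[OF CQ D4]
      by (simp add: less_top[symmetric])
    also have "\<dots> \<le> 3 * measure Q ?C + 6 * (b * measure Q ?C) + (16 * b\<^sup>2) * measure Q ?C"
      using D2 D4 C
      by (intro add_mono mult_left_mono QF.integral_indicator_le_of_real_cond_exp_le mom order_refl) (auto intro: subalgebra_sigma_of)
    also have "\<dots> \<le> \<sigma>^4 * measure Q ?C"
      using mult_right_mono[OF \<sigma>, of "measure Q ?C"] by (simp add: algebra_simps)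
    finally show ?thesis
      by (simp add: ennreal_mult Q.emeasure_eq_measure ennreal_leI)
  qed
  \<comment> \<open>Split the error as V - D: the V part vanishes by independence and zero mean, the
    D part because D is conditionally centred and \<open>C\<close> is an event about W.\<close>
  have first: "integrable ?M (\<lambda>x. indicator C (snd x) * fst x) \<and> (\<integral>x. indicator C (snd x) * fst x \<partial>?M) = 0"
    if C: "C \<in> sets ?F" for C
  proof -
    have CQ[measurable]: "C \<in> sets Q" using C QF.subalg by (auto simp: subalgebra_def)
    have CP[measurable]: "C \<in> sets (PZ \<Otimes>\<^sub>M PW)" using CQ by (simp add: sets_Q)
    let ?a = "\<lambda>x. indicator C (snd x) * fst x :: real" and ?b = "\<lambda>x. indicator C (snd x) * ?D (snd x)"
    have iC: "integrable Q (\<lambda>y. indicator C y * ?D y)"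
      using integrable_mult_indicator[OF CQ D1] by simp
    have iv: "integrable std_gaussian (\<lambda>v. v)" "(\<integral>v. v \<partial>std_gaussian) = 0"
      using std_gaussian_mean by (auto simp: has_bochner_integral_iff)
    have ia: "integrable (std_gaussian \<Otimes>\<^sub>M Q) ?a"
    proof (rule GQ.Fubini_integrable)
      show "integrable std_gaussian (\<lambda>x. \<integral>y. norm (?a (x, y)) \<partial>Q)"
        using iv by (simp add: abs_mult)
    qed (auto simp: less_top[symmetric] intro!: AE_I2)
    have ib: "integrable (std_gaussian \<Otimes>\<^sub>M Q) ?b"
    proof (rule GQ.Fubini_integrable)
      show "integrable std_gaussian (\<lambda>x. \<integral>y. norm (?b (x, y)) \<partial>Q)"
        by simp
    qed (use iC in \<open>auto intro!: AE_I2\<close>)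
    have "(\<integral>x. ?a x \<partial>(std_gaussian \<Otimes>\<^sub>M Q)) = 0"
      using GQ.integral_fst'[OF ia] iv by simp
    moreover have "(\<integral>x. ?b x \<partial>(std_gaussian \<Otimes>\<^sub>M Q)) = 0"
    proof -
      have "(\<integral>y. indicator C y * ?D y \<partial>Q) = (\<integral>y. indicator C y * real_cond_exp Q ?F ?D y \<partial>Q)"
        using QF.real_cond_exp_intA[OF D1 C] by (simp add: set_lebesgue_integral_def)
      also have "\<dots> = (\<integral>y. 0 \<partial>Q)"
        using mom(2) by (intro integral_cong_AE) (auto elim!: eventually_mono)
      finally show ?thesis
        using GQ.integral_fst'[OF ib] G.prob_space by simp
    qed
    moreover have "(\<lambda>x. indicator C (snd x) * (fst x - ?D (snd x))) = (\<lambda>x. ?a x - ?b x)"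
      by (simp add: algebra_simps)
    moreover have "(\<lambda>x. indicator C (snd x) * fst x :: real) \<in> borel_measurable (obs_algebra PZ PW)"
      unfolding obs_algebra_def by measurable
    ultimately show ?thesis
      using ia ib unfolding error_law_def
      by (subst integrable_distr_eq[OF measurable_subtract_error], simp,
          subst integral_distr[OF measurable_subtract_error], simp) simp
  qed
  have sp: "space ?M = space (obs_algebra PZ PW)" by (rule sets_eq_imp_space_eq[OF sets_error_law])
  \<comment> \<open>Every event about W in the space of triples is the preimage under
    \<open>snd\<close> of such an event for \<open>Q\<close>; this transfers the two preceding
    computations.\<close>
  have ind: "(indicator A x :: 'r::zero_neq_one) = indicator (snd -` B \<inter> space Q) (snd x)"
    if "A = (\<lambda>x. snd (snd x)) -` B \<inter> space ?M" "x \<in> space ?M" for x A B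
    using that sets_Q[THEN sets_eq_imp_space_eq] unfolding sp
    by (auto simp: indicator_def obs_algebra_def space_pair_measure)
  have "AE x in ?M. nn_cond_exp ?M FM (\<lambda>x. ennreal ((fst x)^4)) x \<le> ennreal (\<sigma>^4)"
  proof (rule MF.nn_cond_exp_le_const)
    fix A assume "A \<in> sets FM"
    then obtain B where B: "B \<in> sets PW" and A: "A = (\<lambda>x. snd (snd x)) -` B \<inter> space ?M"
      unfolding FM_def sets_sigma_of[OF sM(1)] by auto
    let ?C = "snd -` B \<inter> space Q"
    have "emeasure ?M A = emeasure Q ?C"
    proof -
      have "emeasure Q ?C = emeasure (distr ?M (PZ \<Otimes>\<^sub>M PW) snd) ?C" by (simp add: distr_error_law_snd)
      also have "\<dots> = emeasure ?M (snd -` ?C \<inter> space ?M)"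
        using B by (intro emeasure_distr) (auto simp: sets_Q[symmetric] measurable_cong_sets[OF sets_error_law refl] obs_algebra_def)
      also have "snd -` ?C \<inter> space ?M = A"
        using sets_Q[THEN sets_eq_imp_space_eq] unfolding A sp
        by (auto simp: obs_algebra_def space_pair_measure)
      finally show ?thesis by simp
    qed
    then show "(\<integral>\<^sup>+x. indicator A x * ennreal ((fst x)^4) \<partial>?M) \<le> ennreal (\<sigma>^4) * emeasure ?M A"
      using fourth[OF B] by (simp add: ind[OF A] cong: nn_integral_cong)
  qed measurable
  \<comment> \<open>The case in which \<open>C\<close> is the whole space.\<close>
  moreover have ifst: "integrable ?M fst"
  proof -
    have "space Q \<in> sets ?F" using QF.subalg sets.top[of ?F] by (simp add: subalgebra_def)
    moreover have "snd x \<in> space Q" if "x \<in> space ?M" for x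
      using that sets_Q[THEN sets_eq_imp_space_eq] unfolding sp by (auto simp: obs_algebra_def space_pair_measure)
    ultimately show ?thesis using first[of "space Q"] by (simp cong: Bochner_Integration.integrable_cong)
  qed
  moreover have "AE x in ?M. real_cond_exp ?M FM fst x = 0"
  proof (rule MF.real_cond_exp_charact[OF _ ifst])
    fix A assume "A \<in> sets FM"
    then obtain B where B: "B \<in> sets PW" and A: "A = (\<lambda>x. snd (snd x)) -` B \<inter> space ?M"
      unfolding FM_def sets_sigma_of[OF sM(1)] by auto
    have "snd -` B \<inter> space Q \<in> sets ?F" using B by (subst sets_sigma_of) auto
    from first[OF this] show "(\<integral>x\<in>A. fst x \<partial>?M) = (\<integral>x\<in>A. 0 \<partial>?M)"
      by (simp add: set_lebesgue_integral_def ind[OF A] cong: Bochner_Integration.integral_cong)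
  qed auto
  ultimately show ?thesis
    using ifst unfolding U_class_def FM_def by auto
qed

end

subsection \<open>Finite combinations of basis functions\<close>

lemma L2_add:
  assumes "f \<in> L2 M" "g \<in> L2 M"
  shows "(\<lambda>x. f x + g x) \<in> L2 M"
proof -
  have [measurable]: "f \<in> borel_measurable M" "g \<in> borel_measurable M" using assms by (auto simp: L2_def)
  have "integrable M (\<lambda>x. (f x + g x)\<^sup>2)"
  proof (rule Bochner_Integration.integrable_bound[where f="\<lambda>x. 2 * ((f x)\<^sup>2 + (g x)\<^sup>2)"])
    show "AE x in M. norm ((f x + g x)\<^sup>2) \<le> norm (2 * ((f x)\<^sup>2 + (g x)\<^sup>2))"
    proof (rule AE_I2)
      fix x
      have "(f x + g x)\<^sup>2 \<le> 2 * ((f x)\<^sup>2 + (g x)\<^sup>2)"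
        using zero_le_power2[of "f x - g x"] by (simp add: power2_eq_square algebra_simps)
      then show "norm ((f x + g x)\<^sup>2) \<le> norm (2 * ((f x)\<^sup>2 + (g x)\<^sup>2))" by simp
    qed
  qed (use assms in \<open>auto simp: L2_def\<close>)
  then show ?thesis by (simp add: L2_def)
qed

lemma L2_cmult: "f \<in> L2 M \<Longrightarrow> (\<lambda>x. c * f x) \<in> L2 M"
  by (auto simp: L2_def power_mult_distrib)

lemma L2_sum: "finite J \<Longrightarrow> (\<And>j. j \<in> J \<Longrightarrow> f j \<in> L2 M) \<Longrightarrow> (\<lambda>x. \<Sum>j\<in>J. f j x) \<in> L2 M"
proof (induction J rule: finite_induct)
  case empty
  then show ?case by (simp add: L2_def)
next
  case (insert j J)
  then show ?case using L2_add[of "f j" M "\<lambda>x. \<Sum>j\<in>J. f j x"] by simp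
qed

lemma L2_integrable_mult:
  assumes "f \<in> L2 M" "g \<in> L2 M"
  shows "integrable M (\<lambda>x. f x * g x)"
proof -
  have "integrable M (\<lambda>x. ((f x + g x)\<^sup>2 - (f x)\<^sup>2 - (g x)\<^sup>2) / 2)"
    using assms L2_add[OF assms] by (auto simp: L2_def)
  then show ?thesis by (simp add: power2_eq_square algebra_simps)
qed

lemma coeffs_basis_sum:
  assumes e: "orthonormal_basis M e" and J: "finite J" "J \<subseteq> {1..}" and i: "1 \<le> i"
  shows "coeffs M e (\<lambda>x. \<Sum>j\<in>J. c j * e j x) i = (if i \<in> J then c i else 0)"
proof -
  have mem: "e j \<in> L2 M" if "1 \<le> j" for j
    using e that by (auto simp: orthonormal_basis_def)
  have int: "integrable M (\<lambda>x. e j x * e i x)" if "j \<in> J" for j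
    using that J i by (intro L2_integrable_mult mem) auto
  have "coeffs M e (\<lambda>x. \<Sum>j\<in>J. c j * e j x) i = (\<integral>x. (\<Sum>j\<in>J. c j * (e j x * e i x)) \<partial>M)"
    by (simp add: coeffs_def L2_inner_def sum_distrib_right mult.assoc)
  also have "\<dots> = (\<Sum>j\<in>J. c j * L2_inner M (e j) (e i))"
    using int by (simp add: L2_inner_def)
  also have "\<dots> = (\<Sum>j\<in>J. if j = i then c i else 0)"
    using e J i by (intro sum.cong) (auto simp: orthonormal_basis_def)
  finally show ?thesis using J by simp
qed

text \<open>Turns the weighted norms and the functional \<open>ell\<close>, which are infinite sums,
  into finite ones. Only indices from 1 on are constrained, since the value of a sequence at 0 is
  arbitrary.\<close>

lemma
  fixes u :: "nat \<Rightarrow> real"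
  assumes J: "finite J" "J \<subseteq> {1..}" and u: "\<And>i. 1 \<le> i \<Longrightarrow> u i = (if i \<in> J then v i else 0)"
  shows infsum_finite_support: "(\<Sum>\<^sub>\<infinity>j\<in>{1..}. u j) = (\<Sum>j\<in>J. v j)"
    and summable_on_finite_support: "u summable_on {1..}"
proof -
  have "(\<Sum>\<^sub>\<infinity>j\<in>{1..}. u j) = (\<Sum>\<^sub>\<infinity>j\<in>J. v j)"
    using J u by (intro infsum_cong_neutral) auto
  then show "(\<Sum>\<^sub>\<infinity>j\<in>{1..}. u j) = (\<Sum>j\<in>J. v j)" using J by simp
  have "u summable_on {1..} \<longleftrightarrow> v summable_on J"
    using J u by (intro summable_on_cong_neutral) auto
  then show "u summable_on {1..}" using J by simp
qed

section \<open>Conditional fourth moments of finite combinations\<close>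

text \<open>Cauchy-Schwarz twice: first \<open>\<gamma> j * (c j)\<^sup>2\<close> against
  \<open>(x j)\<^sup>2 / \<gamma> j\<close>, then \<open>1 / \<gamma> j\<close> against
  \<open>(x j)^4 / \<gamma> j\<close>. The result is linear in the fourth powers, so conditional
  expectations can be taken term by term.\<close>

lemma basis_sum_power4_bound:
  fixes \<gamma> c x :: "nat \<Rightarrow> real"
  assumes J: "finite J" and \<gamma>: "\<And>j. j \<in> J \<Longrightarrow> 0 < \<gamma> j"
    and c: "(\<Sum>j\<in>J. \<gamma> j * (c j)\<^sup>2) \<le> \<rho>" and S: "(\<Sum>j\<in>J. 1 / \<gamma> j) \<le> S"
  shows "(\<Sum>j\<in>J. c j * x j)^4 \<le> \<rho>\<^sup>2 * S * (\<Sum>j\<in>J. (x j)^4 / \<gamma> j)"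
proof -
  have \<rho>: "0 \<le> \<rho>" using \<gamma> by (intro order_trans[OF sum_nonneg c]) (auto intro!: mult_nonneg_nonneg intro: less_imp_le)
  let ?T = "\<Sum>j\<in>J. (x j)\<^sup>2 / \<gamma> j"
  have "(\<Sum>j\<in>J. c j * x j)\<^sup>2 = (\<Sum>j\<in>J. (sqrt (\<gamma> j) * c j) * (x j / sqrt (\<gamma> j)))\<^sup>2"
    using \<gamma> by (intro arg_cong[where f="\<lambda>t. t\<^sup>2"] sum.cong refl) (fastforce simp: field_simps)
  also have "\<dots> \<le> (\<Sum>j\<in>J. (sqrt (\<gamma> j) * c j)\<^sup>2) * (\<Sum>j\<in>J. (x j / sqrt (\<gamma> j))\<^sup>2)"
    by (rule Cauchy_Schwarz_ineq_sum)
  also have "\<dots> = (\<Sum>j\<in>J. \<gamma> j * (c j)\<^sup>2) * ?T"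
    using \<gamma> by (simp add: power_mult_distrib power_divide less_imp_le)
  also have "\<dots> \<le> \<rho> * ?T"
    using \<gamma> by (intro mult_right_mono c sum_nonneg) (auto intro!: divide_nonneg_pos)
  finally have 1: "(\<Sum>j\<in>J. c j * x j)\<^sup>2 \<le> \<rho> * ?T" .
  have "?T\<^sup>2 = (\<Sum>j\<in>J. (1 / sqrt (\<gamma> j)) * ((x j)\<^sup>2 / sqrt (\<gamma> j)))\<^sup>2"
    using \<gamma> by (intro arg_cong[where f="\<lambda>t. t\<^sup>2"] sum.cong refl) (auto simp: less_imp_le)
  also have "\<dots> \<le> (\<Sum>j\<in>J. (1 / sqrt (\<gamma> j))\<^sup>2) * (\<Sum>j\<in>J. ((x j)\<^sup>2 / sqrt (\<gamma> j))\<^sup>2)"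
    by (rule Cauchy_Schwarz_ineq_sum)
  also have "\<dots> = (\<Sum>j\<in>J. 1 / \<gamma> j) * (\<Sum>j\<in>J. (x j)^4 / \<gamma> j)"
    using \<gamma> by (simp add: power_divide less_imp_le)
  also have "\<dots> \<le> S * (\<Sum>j\<in>J. (x j)^4 / \<gamma> j)"
    using \<gamma> by (intro mult_right_mono S sum_nonneg) (auto intro!: divide_nonneg_pos)
  finally have 2: "?T\<^sup>2 \<le> S * (\<Sum>j\<in>J. (x j)^4 / \<gamma> j)" .
  have "(\<Sum>j\<in>J. c j * x j)^4 = ((\<Sum>j\<in>J. c j * x j)\<^sup>2)\<^sup>2" by simp
  also have "\<dots> \<le> (\<rho> * ?T)\<^sup>2" using 1 by (intro power_mono) auto
  also have "\<dots> \<le> \<rho>\<^sup>2 * (S * (\<Sum>j\<in>J. (x j)^4 / \<gamma> j))"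
    unfolding power_mult_distrib using 2 by (intro mult_left_mono) auto
  finally show ?thesis by (simp add: mult.assoc)
qed

text \<open>Condition the preceding bound on W. Each fourth moment contributes at most
  \<open>\<eta>^4\<close>, and summing the weights \<open>1 / \<gamma> j\<close> produces a second
  factor \<open>S\<close>; the total is a perfect square, whose root plays the part of
  \<open>b\<close> above.\<close>

lemma basis_sum_conditional_power4:
  fixes \<gamma> c :: "nat \<Rightarrow> real"
  assumes Q: "prob_space Q" and sets_Q: "sets Q = sets (PZ \<Otimes>\<^sub>M PW)"
    and bound: "basis_moment_bound PW e \<eta> Q"
    and J: "finite J" "J \<subseteq> {1..}" and e: "\<And>j. j \<in> J \<Longrightarrow> e j \<in> borel_measurable PZ"
    and \<gamma>: "\<And>j. j \<in> J \<Longrightarrow> 0 < \<gamma> j"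
    and c: "(\<Sum>j\<in>J. \<gamma> j * (c j)\<^sup>2) \<le> \<rho>" and S: "(\<Sum>j\<in>J. 1 / \<gamma> j) \<le> S"
  defines "\<phi> \<equiv> \<lambda>z. \<Sum>j\<in>J. c j * e j z"
  shows "integrable Q (\<lambda>x. (\<phi> (fst x))^4)"
    and "AE x in Q. real_cond_exp Q (sigma_of Q snd PW) (\<lambda>x. (\<phi> (fst x))^4) x \<le> (\<rho> * \<eta>\<^sup>2 * S)\<^sup>2"
proof -
  let ?F = "sigma_of Q snd PW"
  interpret Q: prob_space Q by fact
  note [measurable_cong] = sets_Q
  have "snd \<in> measurable Q PW" by (simp add: measurable_cong_sets[OF sets_Q refl])
  then interpret QF: finite_measure_subalgebra Q ?F
    by unfold_locales (rule subalgebra_sigma_of)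
  have em[measurable]: "(\<lambda>x. e j (fst x)) \<in> borel_measurable Q" if "j \<in> J" for j
    by (rule measurable_compose[OF _ e[OF that]]) (simp add: measurable_cong_sets[OF sets_Q refl])
  have S0: "0 \<le> S" using \<gamma> by (intro order_trans[OF sum_nonneg S]) (auto intro: less_imp_le)
  have nn: "AE x in Q. nn_cond_exp Q ?F (\<lambda>x. ennreal ((e j (fst x))^4)) x \<le> ennreal (\<eta>^4)" if "j \<in> J" for j
    using bound unfolding basis_moment_bound_def
  proof eventually_elim
    case (elim x)
    have "nn_cond_exp Q ?F (\<lambda>x. ennreal ((e j (fst x))^4)) x
        \<le> (SUP j\<in>{1..}. nn_cond_exp Q ?F (\<lambda>x. ennreal ((e j (fst x))^4)) x)"
      using that J by (intro SUP_upper) auto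
    with elim show ?case by simp
  qed
  have ei: "integrable Q (\<lambda>x. (e j (fst x))^4)"
    and ele: "AE x in Q. real_cond_exp Q ?F (\<lambda>x. (e j (fst x))^4) x \<le> \<eta>^4" if "j \<in> J" for j
    by (rule QF.real_cond_exp_le_of_nn_cond_exp_le[OF _ _ _ nn[OF that]], use em[OF that] in simp_all)+
  let ?g = "\<lambda>x. \<rho>\<^sup>2 * S * (\<Sum>j\<in>J. (1 / \<gamma> j) * (e j (fst x))^4)"
  have gi: "integrable Q (\<lambda>x. \<Sum>j\<in>J. (1 / \<gamma> j) * (e j (fst x))^4)" using ei by auto
  have \<phi>m[measurable]: "(\<lambda>x. \<phi> (fst x)) \<in> borel_measurable Q"
    unfolding \<phi>_def by (intro borel_measurable_sum borel_measurable_times em) auto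
  have pt: "(\<phi> (fst x))^4 \<le> ?g x" for x
    unfolding \<phi>_def using basis_sum_power4_bound[OF J(1) \<gamma> c S] by simp
  show i: "integrable Q (\<lambda>x. (\<phi> (fst x))^4)"
  proof (rule Bochner_Integration.integrable_bound[where f="?g"])
    show "AE x in Q. norm ((\<phi> (fst x))^4) \<le> norm (?g x)"
    proof (rule AE_I2)
      fix x
      have "norm ((\<phi> (fst x))^4) = (\<phi> (fst x))^4" by simp
      then show "norm ((\<phi> (fst x))^4) \<le> norm (?g x)"
        using pt[of x] abs_ge_self[of "?g x"] unfolding real_norm_def by linarith
    qed
    show "integrable Q ?g" by (intro integrable_mult_right gi)
  qed measurable
  have "AE x in Q. real_cond_exp Q ?F (\<lambda>x. (\<phi> (fst x))^4) x \<le> real_cond_exp Q ?F ?g x"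
    by (intro QF.real_cond_exp_mono i integrable_mult_right gi AE_I2 pt)
  moreover have "AE x in Q. real_cond_exp Q ?F ?g x
      = (\<rho>\<^sup>2 * S) * real_cond_exp Q ?F (\<lambda>x. \<Sum>j\<in>J. (1 / \<gamma> j) * (e j (fst x))^4) x"
    using gi by (intro QF.real_cond_exp_cmult)
  moreover have "AE x in Q. real_cond_exp Q ?F (\<lambda>x. \<Sum>j\<in>J. (1 / \<gamma> j) * (e j (fst x))^4) x
      = (\<Sum>j\<in>J. real_cond_exp Q ?F (\<lambda>x. (1 / \<gamma> j) * (e j (fst x))^4) x)"
  proof -
    \<comment> \<open>The sum rule asks every member of the family to be integrable, so the terms
      outside \<open>J\<close> are set to 0.\<close>
    have "AE x in Q. real_cond_exp Q ?F (\<lambda>x. \<Sum>j\<in>J. (if j \<in> J then 1 / \<gamma> j * (e j (fst x))^4 else 0)) x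
      = (\<Sum>j\<in>J. real_cond_exp Q ?F (\<lambda>x. if j \<in> J then (1 / \<gamma> j) * (e j (fst x))^4 else 0) x)"
    proof (rule QF.real_cond_exp_sum)
      fix j show "integrable Q (\<lambda>x. if j \<in> J then 1 / \<gamma> j * (e j (fst x))^4 else 0)"
        using ei by (cases "j \<in> J") auto
    qed
    moreover have eq: "(\<lambda>x. \<Sum>j\<in>J. 1 / \<gamma> j * (e j (fst x))^4) = (\<lambda>x. \<Sum>j\<in>J. if j \<in> J then 1 / \<gamma> j * (e j (fst x))^4 else 0)"
      by (intro ext sum.cong) auto
    moreover have "(\<Sum>j\<in>J. real_cond_exp Q ?F (\<lambda>x. if j \<in> J then (1 / \<gamma> j) * (e j (fst x))^4 else 0) x)
        = (\<Sum>j\<in>J. real_cond_exp Q ?F (\<lambda>x. (1 / \<gamma> j) * (e j (fst x))^4) x)" for x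
      by (intro sum.cong) auto
    ultimately show ?thesis by (subst eq) simp
  qed
  moreover have "AE x in Q. \<forall>j\<in>J. real_cond_exp Q ?F (\<lambda>x. (1 / \<gamma> j) * (e j (fst x))^4) x
      = (1 / \<gamma> j) * real_cond_exp Q ?F (\<lambda>x. (e j (fst x))^4) x"
    using J ei by (intro AE_finite_allI QF.real_cond_exp_cmult) auto
  moreover have "AE x in Q. \<forall>j\<in>J. real_cond_exp Q ?F (\<lambda>x. (e j (fst x))^4) x \<le> \<eta>^4"
    using J ele by (intro AE_finite_allI) auto
  ultimately show "AE x in Q. real_cond_exp Q ?F (\<lambda>x. (\<phi> (fst x))^4) x \<le> (\<rho> * \<eta>\<^sup>2 * S)\<^sup>2"
  proof eventually_elim
    case (elim x)
    have "(\<Sum>j\<in>J. real_cond_exp Q ?F (\<lambda>x. (1 / \<gamma> j) * (e j (fst x))^4) x) \<le> (\<Sum>j\<in>J. (1 / \<gamma> j) * \<eta>^4)"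
    proof (rule sum_mono)
      fix j assume j: "j \<in> J"
      then show "real_cond_exp Q ?F (\<lambda>x. (1 / \<gamma> j) * (e j (fst x))^4) x \<le> (1 / \<gamma> j) * \<eta>^4"
        using elim(4)[THEN bspec, OF j] mult_left_mono[OF elim(5)[THEN bspec, OF j], of "1 / \<gamma> j"] \<gamma>[OF j]
        by simp
    qed
    also have "\<dots> = (\<Sum>j\<in>J. 1 / \<gamma> j) * \<eta>^4" by (simp add: sum_distrib_right)
    also have "\<dots> \<le> S * \<eta>^4" using S by (intro mult_right_mono) auto
    finally have "real_cond_exp Q ?F ?g x \<le> (\<rho>\<^sup>2 * S) * (S * \<eta>^4)"
      unfolding elim(2) elim(3) using S0 by (intro mult_left_mono) auto
    also have "\<dots> = (\<rho> * \<eta>\<^sup>2 * S)\<^sup>2" by (simp add: power2_eq_square power4_eq_xxxx)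
    finally show ?case using elim(1) by simp
  qed
qed

subsection \<open>The two hypotheses\<close>

text \<open>The integrand is the geometric mean of the densities for the shifts \<open>\<mu>\<close>
  and \<open>-\<mu>\<close>, whose linear exponents cancel. It depends on W only; apply exp(x) \<ge>
  1 + x and integrate over the marginal \<open>PW\<close>.\<close>

lemma affinity_shifted_gaussian:
  fixes \<mu> :: "'w \<Rightarrow> real"
  assumes Q: "Q \<in> laws_ZW PZ PW" and PW: "prob_space PW" and \<mu>: "\<mu> \<in> L2 PW"
  shows "ennreal (1 - L2_inner PW \<mu> \<mu> / 2) \<le>
    (\<integral>\<^sup>+x. ennreal (exp (- (\<mu> (snd (snd x)))\<^sup>2 / 2)) \<partial>(std_gaussian \<Otimes>\<^sub>M Q))"
proof -
  interpret W: prob_space PW by fact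
  interpret Q: prob_space Q using Q by (simp add: laws_ZW_def)
  interpret G: prob_space std_gaussian by (rule prob_space_std_gaussian)
  interpret GQ: pair_prob_space std_gaussian Q ..
  have sets_Q: "sets Q = sets (PZ \<Otimes>\<^sub>M PW)" and dQ: "distr Q PW snd = PW"
    using Q by (auto simp: laws_ZW_def)
  have [measurable]: "\<mu> \<in> borel_measurable PW" and i: "integrable PW (\<lambda>w. (\<mu> w)\<^sup>2)"
    using \<mu> by (auto simp: L2_def)
  have snd[measurable]: "snd \<in> measurable Q PW" by (simp add: measurable_cong_sets[OF sets_Q refl])
  let ?g = "\<lambda>w. exp (- (\<mu> w)\<^sup>2 / 2)"
  have ig: "integrable PW ?g"
    by (rule W.integrable_const_bound[where B=1]) auto
  have "1 - L2_inner PW \<mu> \<mu> / 2 = (\<integral>w. 1 - (\<mu> w)\<^sup>2 / 2 \<partial>PW)"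
    using i by (simp add: L2_inner_def power2_eq_square W.prob_space)
  also have "\<dots> \<le> (\<integral>w. ?g w \<partial>PW)"
  proof (rule integral_mono)
    show "1 - (\<mu> w)\<^sup>2 / 2 \<le> ?g w" for w
      using exp_ge_add_one_self[of "- (\<mu> w)\<^sup>2 / 2"] by simp
  qed (use i ig in auto)
  finally have "ennreal (1 - L2_inner PW \<mu> \<mu> / 2) \<le> ennreal (\<integral>w. ?g w \<partial>PW)"
    by (rule ennreal_leI)
  also have "\<dots> = (\<integral>\<^sup>+w. ennreal (?g w) \<partial>PW)"
    using ig by (intro nn_integral_eq_integral[symmetric]) auto
  also have "\<dots> = (\<integral>\<^sup>+w. ennreal (?g w) \<partial>distr Q PW snd)" by (simp add: dQ)
  also have "\<dots> = (\<integral>\<^sup>+y. ennreal (?g (snd y)) \<partial>Q)"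
    by (subst nn_integral_distr) auto
  also have "\<dots> = (\<integral>\<^sup>+y. \<integral>\<^sup>+v. ennreal (?g (snd y)) \<partial>std_gaussian \<partial>Q)"
    by (simp add: G.emeasure_space_1[simplified])
  also have "\<dots> = (\<integral>\<^sup>+x. ennreal (?g (snd (snd x))) \<partial>(std_gaussian \<Otimes>\<^sub>M Q))"
    by (subst GQ.nn_integral_snd[symmetric]) auto
  finally show ?thesis .
qed

text \<open>The first condition on \<open>c\<close> puts \<phi> and -\<phi> in the ellipsoid; the
  second, through the upper bound in \<open>T_class\<close>, gives \<open>n\<close> times the
  squared norm of T \<phi> at most 1/2. A finite \<open>J\<close> makes \<phi> an honest function,
  and \<open>S\<close> bounds the weight sum in the moment condition.\<close>

lemma two_hypotheses_lower_bound:
  fixes PZ :: "'z measure" and PW :: "'w measure"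
    and e :: "nat \<Rightarrow> 'z \<Rightarrow> real" and \<gamma> \<upsilon> h c :: "nat \<Rightarrow> real"
  assumes PW: "prob_space PW" and e: "orthonormal_basis PZ e"
    and \<gamma>: "\<And>j. 1 \<le> j \<Longrightarrow> 0 < \<gamma> j"
    and d: "1 \<le> d" and \<rho>: "0 < \<rho>" and \<eta>: "1 \<le> \<eta>" and n: "1 \<le> n"
    and J: "finite J" "J \<subseteq> {1..}"
    and S: "(\<Sum>j\<in>J. 1 / \<gamma> j) \<le> S" "0 < S"
    and \<sigma>: "(sqrt 3 + 4 * \<rho> * \<eta>\<^sup>2 * S)\<^sup>2 \<le> \<sigma>^4"
    and c: "(\<Sum>j\<in>J. \<gamma> j * (c j)\<^sup>2) \<le> \<rho>" and c': "real n * d * (\<Sum>j\<in>J. \<upsilon> j * (c j)\<^sup>2) \<le> 1 / 2"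
    and T: "T \<in> admissible_T PZ PW e \<eta> \<upsilon> d" and l: "l \<in> estimators PZ PW n"
  shows "ennreal ((\<Sum>j\<in>J. h j * c j)\<^sup>2 / 2) \<le>
    (SUP M\<in>admissible_UZW PZ PW e \<eta> \<sigma> T. SUP \<phi>\<in>F_ball_fun PZ e \<gamma> \<rho>. risk PZ PW e h n l M \<phi>)"
    (is "_ \<le> ?R")
proof -
  define \<phi> where "\<phi> = (\<lambda>t::real. \<lambda>z. \<Sum>j\<in>J. (t * c j) * e j z)"
  \<comment> \<open>Taking \<open>t * T (\<phi> 1)\<close> rather than \<open>T (\<phi> t)\<close>
    makes the two shifts exact negatives of each other at every point, not just almost
    everywhere.\<close>
  define \<mu> where "\<mu> = (\<lambda>t::real. \<lambda>w. t * T (\<phi> 1) w)"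
  define L where "L = (\<Sum>j\<in>J. h j * c j)"
  define b where "b = \<rho> * \<eta>\<^sup>2 * S"
  have b: "0 < b" using \<rho> \<eta> S by (simp add: b_def)
  \<comment> \<open>One joint law of (Z, W) is shared by both hypotheses.\<close>
  obtain Q where "Q \<in> admissible_ZW PZ PW e \<eta> T" using T by (auto simp: admissible_T_def)
  then have Q: "Q \<in> laws_ZW PZ PW" and Tce: "is_cond_exp_operator PZ PW Q T" and bmb: "basis_moment_bound PW e \<eta> Q"
    and QQ: "Q \<in> admissible_ZW PZ PW e \<eta> T"
    by (auto simp: admissible_ZW_def)
  have pQ: "prob_space Q" and sets_Q: "sets Q = sets (PZ \<Otimes>\<^sub>M PW)"
    using Q by (auto simp: laws_ZW_def)
  interpret Q: prob_space Q by fact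
  interpret QF: finite_measure_subalgebra Q "sigma_of Q snd PW"
    by unfold_locales (rule subalgebra_sigma_of, simp add: measurable_cong_sets[OF sets_Q refl])
  interpret G: prob_space std_gaussian by (rule prob_space_std_gaussian)
  interpret GQ: pair_prob_space std_gaussian Q ..
  have e_L2: "e j \<in> L2 PZ" if "j \<in> J" for j using e that J by (auto simp: orthonormal_basis_def)
  then have e_meas: "e j \<in> borel_measurable PZ" if "j \<in> J" for j using that by (auto simp: L2_def)
  have \<phi>_L2: "\<phi> t \<in> L2 PZ" for t
    unfolding \<phi>_def using J e_L2 by (intro L2_sum L2_cmult) auto
  then have \<phi>_meas: "\<phi> t \<in> borel_measurable PZ" for t by (auto simp: L2_def)
  have T_L2: "T (\<phi> 1) \<in> L2 PW" using Tce \<phi>_L2 by (auto simp: is_cond_exp_operator_def)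
  then have \<mu>_L2: "\<mu> t \<in> L2 PW" for t unfolding \<mu>_def by (rule L2_cmult)
  then have \<mu>_meas: "\<mu> t \<in> borel_measurable PW" for t by (auto simp: L2_def)
  have coef: "coeffs PZ e (\<phi> t) i = (if i \<in> J then t * c i else 0)" if "1 \<le> i" for t i
    unfolding \<phi>_def by (rule coeffs_basis_sum[OF e J that])
  have ball: "\<phi> t \<in> F_ball_fun PZ e \<gamma> \<rho>" if "t\<^sup>2 = 1" for t
  proof -
    have "(\<lambda>j. \<gamma> j * (coeffs PZ e (\<phi> t) j)\<^sup>2) summable_on {1..}"
      using J by (rule summable_on_finite_support[where v="\<lambda>j. \<gamma> j * (t * c j)\<^sup>2"]) (simp add: coef)
    moreover have "wnorm_sq \<gamma> (coeffs PZ e (\<phi> t)) = (\<Sum>j\<in>J. \<gamma> j * (t * c j)\<^sup>2)"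
      unfolding wnorm_sq_def using J by (rule infsum_finite_support) (simp add: coef)
    ultimately show ?thesis
      using c \<phi>_L2 that by (simp add: F_ball_fun_def F_ball_def F_space_def power_mult_distrib)
  qed
  have ell: "ell h (coeffs PZ e (\<phi> t)) = t * L" for t
  proof -
    have "ell h (coeffs PZ e (\<phi> t)) = (\<Sum>j\<in>J. h j * (t * c j))"
      unfolding ell_def using J by (rule infsum_finite_support) (simp add: coef)
    then show ?thesis by (simp add: L_def sum_distrib_left mult.left_commute)
  qed
  have law: "error_law PZ PW Q (\<phi> t) (\<mu> t) \<in> admissible_UZW PZ PW e \<eta> \<sigma> T" if t: "t\<^sup>2 = 1" for t
  proof -
    have "(\<Sum>j\<in>J. \<gamma> j * (t * c j)\<^sup>2) \<le> \<rho>" using c t by (simp add: power_mult_distrib)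
    then have p4: "integrable Q (\<lambda>x. (\<phi> t (fst x))^4)"
      "AE x in Q. real_cond_exp Q (sigma_of Q snd PW) (\<lambda>x. (\<phi> t (fst x))^4) x \<le> b\<^sup>2"
      unfolding \<phi>_def b_def
      using \<gamma> J by (intro basis_sum_conditional_power4[OF pQ sets_Q bmb J e_meas _ _ S(1)], auto)+
    have i1: "integrable Q (\<lambda>x. \<phi> 1 (fst x))"
    proof -
      have "integrable Q (\<lambda>x. (\<phi> 1 (fst x))^4)"
        unfolding \<phi>_def
        using \<gamma> J c by (intro basis_sum_conditional_power4[OF pQ sets_Q bmb J e_meas _ _ S(1)]) auto
      moreover have "(\<lambda>x. \<phi> 1 (fst x)) \<in> borel_measurable Q"
        by (rule measurable_compose[OF _ \<phi>_meas]) (simp add: measurable_cong_sets[OF sets_Q refl])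
      ultimately show ?thesis by (rule QF.integrable_powers_of_power4(2)[rotated])
    qed
    have "\<phi> t = (\<lambda>z. t * \<phi> 1 z)" by (simp add: \<phi>_def sum_distrib_left mult.assoc)
    moreover have "AE x in Q. T (\<phi> 1) (snd x) = real_cond_exp Q (sigma_of Q snd PW) (\<lambda>x. \<phi> 1 (fst x)) x"
      using Tce \<phi>_L2 by (auto simp: is_cond_exp_operator_def)
    ultimately have eq: "AE x in Q. \<mu> t (snd x) = real_cond_exp Q (sigma_of Q snd PW) (\<lambda>x. \<phi> t (fst x)) x"
      using QF.real_cond_exp_cmult[OF i1, of t] by (auto elim!: eventually_elim2 simp: \<mu>_def)
    \<comment> \<open>Since 6 \<le> 8 sqrt 3, the fourth moment bound 3 + 6 b + 16 b^2 is at most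
      (sqrt 3 + 4 b)^2, which is the form of the condition on \<open>\<sigma>\<close>.\<close>
    have s3: "1 \<le> sqrt 3" by simp
    then have s3': "6 \<le> 8 * sqrt 3" by linarith
    have "3 + 6 * b + 16 * b\<^sup>2 \<le> 3 + 8 * sqrt 3 * b + 16 * b\<^sup>2"
      using mult_right_mono[OF s3', of b] b by simp
    also have "\<dots> = (sqrt 3 + 4 * \<rho> * \<eta>\<^sup>2 * S)\<^sup>2"
      by (simp add: power2_sum b_def power_mult_distrib)
    finally have "3 + 6 * b + 16 * b\<^sup>2 \<le> \<sigma>^4" using \<sigma> by simp
    then have "error_law PZ PW Q (\<phi> t) (\<mu> t) \<in> U_class PW \<sigma>"
      using error_law_in_U_class[OF pQ sets_Q \<phi>_meas \<mu>_meas p4 b eq] by simp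
    then show ?thesis
      using QQ prob_space_error_law[OF pQ sets_Q \<phi>_meas \<mu>_meas]
      by (simp add: admissible_UZW_def sets_error_law[OF pQ sets_Q \<phi>_meas \<mu>_meas] distr_error_law_snd[OF pQ sets_Q \<phi>_meas \<mu>_meas])
  qed
  let ?B = "std_gaussian \<Otimes>\<^sub>M Q"
  define p where "p = (\<lambda>t (x :: real \<times> 'z \<times> 'w). exp (\<mu> t (snd (snd x)) * fst x - (\<mu> t (snd (snd x)))\<^sup>2 / 2))"
  have ml: "model_law PZ PW (error_law PZ PW Q (\<phi> t) (\<mu> t)) (\<phi> t) = density ?B (\<lambda>x. ennreal (p t x))" for t
    unfolding p_def by (rule model_law_error_law[OF pQ sets_Q \<phi>_meas \<mu>_meas])
  have sets_B: "sets ?B = sets (obs_algebra PZ PW)"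
    by (rule sets_std_gaussian_pair[OF pQ sets_Q \<phi>_meas \<mu>_meas])
  have p_meas: "p t \<in> borel_measurable ?B" for t
  proof -
    note [measurable] = \<mu>_meas
    show ?thesis unfolding p_def measurable_cong_sets[OF sets_B refl] unfolding obs_algebra_def by measurable
  qed
  have l_meas: "l \<in> borel_measurable (PiM {1..n} (\<lambda>_. ?B))"
    using l unfolding estimators_def
    by (subst measurable_cong_sets[OF sets_PiM_cong[OF refl sets_B] refl])
  have pd: "prob_space (density ?B (\<lambda>x. ennreal (p t x)))" for t
  proof -
    interpret M: prob_space "error_law PZ PW Q (\<phi> t) (\<mu> t)"
      by (rule prob_space_error_law[OF pQ sets_Q \<phi>_meas \<mu>_meas])
    have "(\<lambda>(u, z, w). (\<phi> t z + u, z, w)) \<in> measurable (error_law PZ PW Q (\<phi> t) (\<mu> t)) (obs_algebra PZ PW)"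
      unfolding measurable_cong_sets[OF sets_error_law[OF pQ sets_Q \<phi>_meas \<mu>_meas] refl] obs_algebra_def
      using \<phi>_meas[of t] by measurable
    then show ?thesis
      unfolding ml[symmetric] model_law_def by (rule M.prob_space_distr)
  qed
  have risk: "risk PZ PW e h n l (error_law PZ PW Q (\<phi> t) (\<mu> t)) (\<phi> t) =
     (\<integral>\<^sup>+s. ennreal ((l s - t * L)\<^sup>2) \<partial>PiM {1..n} (\<lambda>_. density ?B (\<lambda>x. ennreal (p t x))))" for t
    unfolding risk_def ml ell by simp
  have le: "risk PZ PW e h n l (error_law PZ PW Q (\<phi> t) (\<mu> t)) (\<phi> t) \<le> ?R" if "t\<^sup>2 = 1" for t
    using law[OF that] ball[OF that] by (meson SUP_upper2 order_refl)
  \<comment> \<open>With \<open>\<delta>\<close> half the squared norm of T \<phi>, the affinity of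
    one observation is at least 1 - \<delta>. As n \<delta> \<le> 1/4, Bernoulli's inequality keeps
    its n-th power above 3/4.\<close>
  have aff: "ennreal (3 / 4) \<le> (\<integral>\<^sup>+x. ennreal (sqrt (p 1 x * p (-1) x)) \<partial>?B) ^ card {1..n}"
  proof -
    define \<delta> where "\<delta> = L2_inner PW (\<mu> 1) (\<mu> 1) / 2"
    have "(L2_norm PW (T (\<phi> 1)))\<^sup>2 \<le> d * wnorm_sq \<upsilon> (coeffs PZ e (\<phi> 1))"
      using T \<phi>_L2 by (auto simp: admissible_T_def T_class_def)
    also have "wnorm_sq \<upsilon> (coeffs PZ e (\<phi> 1)) = (\<Sum>j\<in>J. \<upsilon> j * (c j)\<^sup>2)"
      unfolding wnorm_sq_def using J by (rule infsum_finite_support) (simp add: coef)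
    finally have "(L2_norm PW (T (\<phi> 1)))\<^sup>2 \<le> d * (\<Sum>j\<in>J. \<upsilon> j * (c j)\<^sup>2)" .
    moreover have \<delta>0: "0 \<le> \<delta>" unfolding \<delta>_def L2_inner_def by (intro divide_nonneg_nonneg integral_nonneg) auto
    moreover have "(L2_norm PW (T (\<phi> 1)))\<^sup>2 = 2 * \<delta>"
      using \<delta>0 by (simp add: L2_norm_def \<delta>_def \<mu>_def)
    ultimately have "2 * \<delta> \<le> d * (\<Sum>j\<in>J. \<upsilon> j * (c j)\<^sup>2)" by simp
    then have "real n * (2 * \<delta>) \<le> real n * (d * (\<Sum>j\<in>J. \<upsilon> j * (c j)\<^sup>2))"
      by (intro mult_left_mono) auto
    then have n\<delta>: "real n * \<delta> \<le> 1 / 4" using c' by simp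
    have "\<delta> \<le> real n * \<delta>" using n \<delta>0 by (simp add: mult_le_cancel_right1)
    then have \<delta>1: "\<delta> \<le> 1" using n\<delta> by simp
    have "3 / 4 \<le> 1 - real n * \<delta>" using n\<delta> by simp
    also have "\<dots> \<le> (1 - \<delta>) ^ n"
      using Bernoulli_inequality[of "- \<delta>" n] \<delta>1 by simp
    finally have "ennreal (3 / 4) \<le> ennreal (1 - \<delta>) ^ n"
      using \<delta>1 by (simp add: ennreal_power ennreal_leI)
    also have "\<dots> \<le> (\<integral>\<^sup>+x. ennreal (exp (- (\<mu> 1 (snd (snd x)))\<^sup>2 / 2)) \<partial>?B) ^ n"
      unfolding \<delta>_def by (intro power_mono affinity_shifted_gaussian[OF Q PW \<mu>_L2]) auto
    also have "(\<lambda>x. exp (- (\<mu> 1 (snd (snd x)))\<^sup>2 / 2)) = (\<lambda>x. sqrt (p 1 x * p (-1) x))"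
    proof
      fix x
      have "p 1 x * p (-1) x = (exp (- (\<mu> 1 (snd (snd x)))\<^sup>2 / 2))\<^sup>2"
        by (simp add: p_def \<mu>_def exp_add[symmetric] exp_double[symmetric])
      then show "exp (- (\<mu> 1 (snd (snd x)))\<^sup>2 / 2) = sqrt (p 1 x * p (-1) x)" by simp
    qed
    finally show ?thesis by simp
  qed
  \<comment> \<open>Both risks are at most \<open>?R\<close>, so 3 L^2 \<le> 2 \<open>?R\<close> + 2
    L^2. The common term is then cancelled in the reals, an infinite \<open>?R\<close> being
    trivial.\<close>
  have "ennreal (3 * L\<^sup>2) = ennreal (4 * L\<^sup>2) * ennreal (3 / 4)"
    by (simp add: ennreal_mult[symmetric])
  also have "\<dots> \<le> ennreal (4 * L\<^sup>2) * (\<integral>\<^sup>+x. ennreal (sqrt (p 1 x * p (-1) x)) \<partial>?B) ^ card {1..n}"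
    using aff by (intro mult_left_mono) auto
  also have "\<dots> \<le> (\<integral>\<^sup>+s. ennreal ((l s - L)\<^sup>2) \<partial>PiM {1..n} (\<lambda>_. density ?B (\<lambda>x. ennreal (p 1 x)))) +
      (\<integral>\<^sup>+s. ennreal ((l s + L)\<^sup>2) \<partial>PiM {1..n} (\<lambda>_. density ?B (\<lambda>x. ennreal (p (-1) x)))) + ennreal (2 * L\<^sup>2)"
    by (rule two_point_risk) (use p_meas pd l_meas in \<open>auto simp: p_def intro: GQ.prob_space_axioms\<close>)
  also have "\<dots> \<le> ?R + ?R + ennreal (2 * L\<^sup>2)"
    using le[of 1] le[of "-1"] unfolding risk by (intro add_mono) auto
  finally have main: "ennreal (3 * L\<^sup>2) \<le> ?R + ?R + ennreal (2 * L\<^sup>2)" .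
  show ?thesis
  proof (cases ?R)
    case (real r)
    then have "ennreal (3 * L\<^sup>2) \<le> ennreal (r + r + 2 * L\<^sup>2)"
      using main unfolding real by (simp add: ennreal_plus[symmetric] del: ennreal_plus)
    then have "3 * L\<^sup>2 \<le> r + r + 2 * L\<^sup>2"
      using real by (subst (asm) ennreal_le_iff) auto
    then show ?thesis unfolding real L_def[symmetric] by (intro ennreal_leI) auto
  next
    case top
    show ?thesis unfolding top by (rule top_greatest)
  qed
qed

subsection \<open>The rate\<close>

text \<open>Gives \<open>LEAST\<close> its meaning by exhibiting a minimiser. Since \<upsilon> tends
  to 0 and \<gamma> \<ge> 1, from some index on \<open>balance\<close> is at least its value at 1; a
  minimum over the finitely many remaining indices is therefore global.\<close>

lemma m_star_ge_1:
  assumes "regular_weights \<gamma> \<upsilon>" and x: "0 < x"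
  shows "1 \<le> m_star \<gamma> \<upsilon> x"
proof -
  let ?f = "balance \<gamma> \<upsilon> x"
  have pos: "\<And>j. 1 \<le> j \<Longrightarrow> 0 < \<gamma> j \<and> 0 < \<upsilon> j" and one: "\<gamma> 1 = 1" and mono: "mono_on {1..} \<gamma>"
    and lim: "\<upsilon> \<longlonglongrightarrow> 0"
    using assms by (auto simp: regular_weights_def)
  have f1: "0 < ?f 1"
    using pos[of 1] x by (auto simp: balance_def intro!: divide_pos_pos simp: less_max_iff_disj)
  \<comment> \<open>This threshold makes (1 / x) / \<upsilon>(k), and a fortiori
    \<open>balance\<close> at \<open>k\<close>, at least \<open>?f 1\<close>.\<close>
  have "eventually (\<lambda>k. \<upsilon> k < 1 / (x * ?f 1)) sequentially"
    using f1 x by (intro order_tendstoD(2)[OF lim]) simp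
  then obtain K where K: "\<And>k. K \<le> k \<Longrightarrow> \<upsilon> k < 1 / (x * ?f 1)"
    by (auto simp: eventually_sequentially)
  have large: "?f 1 \<le> ?f k" if "1 \<le> k" "K \<le> k" for k
  proof -
    have p: "0 < \<gamma> k" "0 < \<upsilon> k" using pos that by auto
    have "1 \<le> \<gamma> k" using mono_onD[OF mono, of 1 k] that one by auto
    then have "\<upsilon> k / \<gamma> k \<le> \<upsilon> k" using p by (simp add: divide_le_eq)
    also have "\<dots> \<le> 1 / (x * ?f 1)" using K[OF that(2)] by simp
    finally have "?f 1 \<le> (1 / x) / (\<upsilon> k / \<gamma> k)"
      using p f1 x by (simp add: field_simps)
    also have "\<dots> \<le> ?f k"
      unfolding balance_def using p x by (intro frac_le) (auto simp: le_max_iff_disj)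
    finally show ?thesis .
  qed
  obtain m where m: "m \<in> {1..max 1 K}" "?f m = Min (?f ` {1..max 1 K})"
    using Min_in[of "?f ` {1..max 1 K}"] by fastforce
  have min: "?f m \<le> ?f k" if "k \<in> {1..max 1 K}" for k
    unfolding m(2) using that by (intro Min_le) auto
  have "?f m \<le> ?f k" if "1 \<le> k" for k
  proof (cases "k \<le> max 1 K")
    case False
    then have "K \<le> k" by simp
    then show ?thesis using min[of 1] large[OF that] by simp
  qed (use min that in auto)
  then have "\<exists>m. m \<ge> 1 \<and> (\<forall>k\<ge>1. ?f m \<le> ?f k)" using m(1) by auto
  then show ?thesis unfolding m_star_def by (rule LeastI2_ex) simp
qed

text \<open>The infimum defining \<open>kappa\<close> lies below its member at \<open>n\<close>
  because the family is bounded below by 0. The first bound serves to keep the low-frequency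
  perturbation in the ellipsoid, the second to keep perturbations undetectable from \<open>n\<close>
  observations.\<close>

lemma kappa_alpha_star_le:
  assumes reg: "regular_weights \<gamma> \<upsilon>" and n: "1 \<le> n"
  defines "m \<equiv> m_star \<gamma> \<upsilon> (real n)"
  shows "kappa \<gamma> \<upsilon> * alpha_star \<gamma> \<upsilon> (real n) \<le> \<upsilon> m / \<gamma> m"
    and "kappa \<gamma> \<upsilon> * alpha_star \<gamma> \<upsilon> (real n) \<le> 1 / real n"
proof -
  let ?r = "\<lambda>n. inverse (alpha_star \<gamma> \<upsilon> (real n)) *
     min (\<upsilon> (m_star \<gamma> \<upsilon> (real n)) / \<gamma> (m_star \<gamma> \<upsilon> (real n))) (1 / real n)"
  have \<alpha>: "0 < alpha_star \<gamma> \<upsilon> (real k)" if "1 \<le> k" for k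
    using that by (simp add: alpha_star_def less_max_iff_disj)
  have "0 \<le> ?r k" if "1 \<le> k" for k
  proof -
    have "1 \<le> m_star \<gamma> \<upsilon> (real k)" using that by (intro m_star_ge_1[OF reg]) simp
    then show ?thesis using reg \<alpha>[OF that] by (auto simp: regular_weights_def less_imp_le)
  qed
  then have "bdd_below (?r ` {1..})" by (intro bdd_belowI2[where m=0]) auto
  then have "kappa \<gamma> \<upsilon> \<le> ?r n"
    unfolding kappa_def using n by (intro cINF_lower) auto
  then have "kappa \<gamma> \<upsilon> * alpha_star \<gamma> \<upsilon> (real n) \<le> ?r n * alpha_star \<gamma> \<upsilon> (real n)"
    using \<alpha>[OF n] by (intro mult_right_mono) auto
  also have "\<dots> = min (\<upsilon> m / \<gamma> m) (1 / real n)"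
    using \<alpha>[OF n] by (simp add: m_def field_simps)
  finally show "kappa \<gamma> \<upsilon> * alpha_star \<gamma> \<upsilon> (real n) \<le> \<upsilon> m / \<gamma> m"
    "kappa \<gamma> \<upsilon> * alpha_star \<gamma> \<upsilon> (real n) \<le> 1 / real n" by auto
qed

text \<open>Eventually \<open>\<gamma> j\<close> exceeds j^3, so the series is dominated by that of
  the inverse cubes.\<close>

lemma inverse_weights_summable_on:
  fixes \<gamma> :: "nat \<Rightarrow> real"
  assumes pos: "\<And>j. 1 \<le> j \<Longrightarrow> 0 < \<gamma> j" and lim: "(\<lambda>j. real j ^ 3 / \<gamma> j) \<longlonglongrightarrow> 0"
  shows "(\<lambda>j. 1 / \<gamma> j) summable_on {1..}"
proof -
  have "eventually (\<lambda>j. real j ^ 3 / \<gamma> j < 1) sequentially"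
    using lim by (rule order_tendstoD) simp
  then have "eventually (\<lambda>j. norm (norm (1 / \<gamma> j)) \<le> inverse (real j ^ 3)) sequentially"
    using eventually_ge_at_top[of 1]
  proof eventually_elim
    case (elim j)
    then show ?case using pos[of j] by (simp add: field_simps)
  qed
  then have "summable (\<lambda>j. norm (1 / \<gamma> j))"
    by (rule summable_comparison_test_ev) (simp add: inverse_power_summable)
  then have "(\<lambda>j. 1 / \<gamma> j) summable_on UNIV"
    by (rule norm_summable_imp_summable_on)
  then show ?thesis by (rule summable_on_subset_banach) simp
qed

section \<open>Choice of the least favourable coefficients and assembly of the bound\<close>

theorem theorem2p1:
  fixes PZ :: "'z measure" and PW :: "'w measure"
    and e :: "nat \<Rightarrow> 'z \<Rightarrow> real"
    and \<gamma> \<upsilon> h :: "nat \<Rightarrow> real"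
    and \<rho> d \<eta> \<sigma> :: real and n :: nat
  assumes "prob_space PZ" and "prob_space PW"
    and "orthonormal_basis PZ e"
    and "regular_weights \<gamma> \<upsilon>" and "balanced_weights \<gamma> \<upsilon>"
    and "h \<in> F_space (\<lambda>j. 1 / \<gamma> j)"
    and "\<rho> > 0" and "d \<ge> 1" and "\<eta> \<ge> 1"
    and "\<sigma>^4 \<ge> (sqrt 3 + 4 * \<rho> * \<eta>\<^sup>2 * (\<Sum>\<^sub>\<infinity>j\<in>{1..}. 1 / \<gamma> j))\<^sup>2"
    and "n \<ge> 1"
  shows "(INF l\<in>estimators PZ PW n.
          INF T\<in>admissible_T PZ PW e \<eta> \<upsilon> d.
          SUP M\<in>admissible_UZW PZ PW e \<eta> \<sigma> T.
          SUP \<phi>\<in>F_ball_fun PZ e \<gamma> \<rho>. risk PZ PW e h n l M \<phi>)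
       \<ge> ennreal (kappa \<gamma> \<upsilon> / 4 * min (1 / (2 * d)) \<rho> * rate \<gamma> \<upsilon> h (real n))"
proof (intro INF_greatest)
  fix l T assume l: "l \<in> estimators PZ PW n" and T: "T \<in> admissible_T PZ PW e \<eta> \<upsilon> d"
  let ?R = "SUP M\<in>admissible_UZW PZ PW e \<eta> \<sigma> T. SUP \<phi>\<in>F_ball_fun PZ e \<gamma> \<rho>. risk PZ PW e h n l M \<phi>"
  define S where "S = (\<Sum>\<^sub>\<infinity>j\<in>{1..}. 1 / \<gamma> j)"
  define m where "m = m_star \<gamma> \<upsilon> (real n)"
  define \<alpha> where "\<alpha> = alpha_star \<gamma> \<upsilon> (real n)"
  define \<kappa> where "\<kappa> = kappa \<gamma> \<upsilon>"
  \<comment> \<open>The bound \<beta> \<le> \<rho> serves the ellipsoid constraint and d \<beta>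
    \<le> 1/2 the indistinguishability constraint. The factor \<kappa> in \<open>\<zeta>\<close>
    pays for the imbalance between \<open>\<upsilon> m / \<gamma> m\<close> and 1/n.\<close>
  define \<beta> where "\<beta> = min (1 / (2 * d)) \<rho>"
  define \<zeta> where "\<zeta> = \<kappa> * \<beta>"
  have \<gamma>: "0 < \<gamma> j" and \<upsilon>: "0 < \<upsilon> j" if "1 \<le> j" for j
    using assms(4) that by (auto simp: regular_weights_def)
  have \<gamma>mono: "\<gamma> i \<le> \<gamma> j" and \<upsilon>mono: "\<upsilon> j \<le> \<upsilon> i" if "1 \<le> i" "i \<le> j" for i j
    using assms(4) that by (auto simp: regular_weights_def monotone_on_def)
  have m: "1 \<le> m" unfolding m_def using assms(4,11) by (intro m_star_ge_1) auto
  have sum\<gamma>: "(\<lambda>j. 1 / \<gamma> j) summable_on {1..}"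
    using assms(4) by (intro inverse_weights_summable_on) (auto simp: regular_weights_def)
  have S: "(\<Sum>j\<in>J. 1 / \<gamma> j) \<le> S" if "finite J" "J \<subseteq> {1..}" for J
    unfolding S_def using that \<gamma> by (intro finite_sum_le_infsum sum\<gamma>) (auto intro: less_imp_le)
  have S_pos: "0 < S" using S[of "{1}"] \<gamma>[of 1] by (auto elim: less_le_trans[rotated])
  have \<kappa>: "0 < \<kappa>" "\<kappa> \<le> 1" using assms(5) by (auto simp: balanced_weights_def \<kappa>_def)
  have \<beta>: "0 < \<beta>" "\<beta> \<le> \<rho>" "d * \<beta> \<le> 1 / 2"
    using assms(7,8) by (auto simp: \<beta>_def min_def field_simps)
  have \<zeta>: "0 < \<zeta>" using \<kappa> \<beta> by (simp add: \<zeta>_def)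
  have \<kappa>\<alpha>: "\<kappa> * \<alpha> \<le> \<upsilon> m / \<gamma> m" "real n * (\<kappa> * \<alpha>) \<le> 1"
    using kappa_alpha_star_le[OF assms(4,11)] assms(11)
    by (auto simp: \<kappa>_def \<alpha>_def m_def field_simps)
  have \<alpha>: "\<upsilon> m / \<gamma> m \<le> \<alpha>" "0 < \<alpha>"
    using assms(11) by (auto simp: \<alpha>_def alpha_star_def m_def less_max_iff_disj)
  have scale: "real n * d * (\<zeta> * a) \<le> 1 / 2" if "0 \<le> a" "a \<le> \<alpha>" for a
  proof -
    have "real n * d * (\<zeta> * a) = (d * \<beta>) * (real n * (\<kappa> * a))" by (simp add: \<zeta>_def)
    also have "\<dots> \<le> (d * \<beta>) * (real n * (\<kappa> * \<alpha>))"
      using that \<kappa> \<beta> assms(8) by (intro mult_left_mono) auto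
    also have "\<dots> \<le> (1 / 2) * 1"
      using \<kappa>\<alpha>(2) \<beta> \<kappa> \<alpha> by (intro mult_mono) auto
    finally show ?thesis by simp
  qed
  have key: "ennreal ((\<Sum>j\<in>J. h j * c j)\<^sup>2 / 2) \<le> ?R"
    if "finite J" "J \<subseteq> {1..}" "(\<Sum>j\<in>J. \<gamma> j * (c j)\<^sup>2) \<le> \<rho>" "real n * d * (\<Sum>j\<in>J. \<upsilon> j * (c j)\<^sup>2) \<le> 1 / 2" for J c
    using two_hypotheses_lower_bound[OF assms(2,3) \<gamma> assms(8,7,9,11) that(1,2) S[OF that(1,2)] S_pos
        assms(10)[folded S_def] that(3,4) T l] .
  have low: "ennreal (\<zeta> / 4 * (\<alpha> * (\<Sum>j=1..m. (h j)\<^sup>2 / \<upsilon> j))) \<le> ?R"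
  proof -
    define s where "s = (\<Sum>j=1..m. (h j)\<^sup>2 / \<upsilon> j)"
    have s0: "0 \<le> s" unfolding s_def using \<upsilon> by (intro sum_nonneg divide_nonneg_pos) auto
    show ?thesis
    proof (cases "s = 0")
      case False
      with s0 have s: "0 < s" by simp
      \<comment> \<open>Coefficients proportional to h / \<upsilon> give equality in Cauchy-Schwarz
        for a prescribed sum of \<open>\<upsilon> j * (c j)\<^sup>2\<close>; \<open>t\<close> makes
        that sum equal to \<zeta> \<alpha>, and the squared functional becomes \<zeta> \<alpha>
        s.\<close>
      define t where "t = sqrt (\<zeta> * \<alpha> / s)"
      have t2: "t\<^sup>2 * s = \<zeta> * \<alpha>" using s \<zeta> \<alpha> by (simp add: t_def)
      define c where "c = (\<lambda>j. t * (h j / \<upsilon> j))"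
      have "(\<Sum>j=1..m. h j * c j) = t * s"
        by (simp add: c_def s_def sum_distrib_left power2_eq_square mult_ac)
      then have val: "(\<Sum>j=1..m. h j * c j)\<^sup>2 = \<zeta> * \<alpha> * s"
        using t2 by (simp add: power_mult_distrib power2_eq_square mult_ac)
      have "(\<Sum>j=1..m. \<upsilon> j * (c j)\<^sup>2) = (\<Sum>j=1..m. t\<^sup>2 * ((h j)\<^sup>2 / \<upsilon> j))"
        using \<upsilon> by (intro sum.cong refl) (fastforce simp: c_def power2_eq_square field_simps)
      then have 2: "(\<Sum>j=1..m. \<upsilon> j * (c j)\<^sup>2) = \<zeta> * \<alpha>"
        by (simp only: sum_distrib_left[symmetric] s_def[symmetric] t2)
      have "(\<Sum>j=1..m. \<gamma> j * (c j)\<^sup>2) = (\<Sum>j=1..m. (\<gamma> j / \<upsilon> j) * (\<upsilon> j * (c j)\<^sup>2))"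
        using \<upsilon> by (intro sum.cong refl) (fastforce simp: field_simps)
      \<comment> \<open>Up to \<open>m\<close> the ratio \<gamma> / \<upsilon> is largest at
        \<open>m\<close>, as \<gamma> increases and \<upsilon> decreases.\<close>
      also have "\<dots> \<le> (\<Sum>j=1..m. (\<gamma> m / \<upsilon> m) * (\<upsilon> j * (c j)\<^sup>2))"
        using \<gamma> \<upsilon> \<gamma>mono \<upsilon>mono m
        by (intro sum_mono mult_right_mono frac_le) (auto intro!: mult_nonneg_nonneg intro: less_imp_le)
      also have "\<dots> = (\<gamma> m / \<upsilon> m) * (\<zeta> * \<alpha>)" by (simp only: sum_distrib_left[symmetric] 2)
      also have "\<dots> = \<beta> * ((\<gamma> m / \<upsilon> m) * (\<kappa> * \<alpha>))" by (simp add: \<zeta>_def)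
      also have "\<dots> \<le> \<beta> * ((\<gamma> m / \<upsilon> m) * (\<upsilon> m / \<gamma> m))"
        using \<kappa>\<alpha>(1) \<beta> \<gamma>[OF m] \<upsilon>[OF m] by (intro mult_left_mono) auto
      also have "\<dots> = \<beta>" using \<gamma>[OF m] \<upsilon>[OF m] by simp
      finally have 1: "(\<Sum>j=1..m. \<gamma> j * (c j)\<^sup>2) \<le> \<rho>" using \<beta> by simp
      have "ennreal (\<zeta> / 4 * (\<alpha> * s)) \<le> ennreal (\<zeta> * \<alpha> * s / 2)"
        using \<zeta> \<alpha> s by (intro ennreal_leI) simp
      also have "\<dots> \<le> ?R"
        using key[of "{1..m}" c] 1 2 scale[of \<alpha>] \<alpha> unfolding val by simp
      finally show ?thesis by (simp add: s_def)
    next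
      case True
      then show ?thesis unfolding s_def[symmetric] by simp
    qed
  qed
  \<comment> \<open>Beyond \<open>m\<close> the constraints exchange roles: coefficients
    proportional to h / \<gamma> are normalised in the \<gamma>-norm, and the \<upsilon>-norm has to
    be estimated.\<close>
  have tail: "ennreal (\<zeta> / 2 * (\<Sum>j\<in>J. (h j)\<^sup>2 / \<gamma> j)) \<le> ?R" if J: "finite J" "J \<subseteq> {m<..}" for J
  proof -
    have J1: "J \<subseteq> {1..}" using J(2) by auto
    have \<gamma>J: "0 < \<gamma> j" "0 < \<upsilon> j" if "j \<in> J" for j using that J1 \<gamma> \<upsilon> by auto
    define s where "s = (\<Sum>j\<in>J. (h j)\<^sup>2 / \<gamma> j)"
    have s0: "0 \<le> s" unfolding s_def using \<gamma>J by (intro sum_nonneg divide_nonneg_pos) auto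
    show ?thesis
    proof (cases "s = 0")
      case False
      with s0 have s: "0 < s" by simp
      define t where "t = sqrt (\<zeta> / s)"
      have t2: "t\<^sup>2 * s = \<zeta>" using s \<zeta> by (simp add: t_def)
      define c where "c = (\<lambda>j. t * (h j / \<gamma> j))"
      have "(\<Sum>j\<in>J. h j * c j) = t * s"
        by (simp add: c_def s_def sum_distrib_left power2_eq_square mult_ac)
      then have val: "(\<Sum>j\<in>J. h j * c j)\<^sup>2 = \<zeta> * s"
        using t2 by (simp add: power_mult_distrib power2_eq_square mult_ac)
      have "(\<Sum>j\<in>J. \<gamma> j * (c j)\<^sup>2) = (\<Sum>j\<in>J. t\<^sup>2 * ((h j)\<^sup>2 / \<gamma> j))"
        using \<gamma>J by (intro sum.cong refl) (fastforce simp: c_def power2_eq_square field_simps)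
      then have 1: "(\<Sum>j\<in>J. \<gamma> j * (c j)\<^sup>2) = \<zeta>"
        by (simp only: sum_distrib_left[symmetric] s_def[symmetric] t2)
      have "(\<Sum>j\<in>J. \<upsilon> j * (c j)\<^sup>2) = (\<Sum>j\<in>J. (\<upsilon> j / \<gamma> j) * (\<gamma> j * (c j)\<^sup>2))"
        using \<gamma>J by (intro sum.cong refl) (fastforce simp: field_simps)
      \<comment> \<open>Beyond \<open>m\<close> the ratio \<upsilon> / \<gamma> is at most its value
        at \<open>m\<close>, hence at most \<alpha>, so \<open>scale\<close> applies.\<close>
      also have "\<dots> \<le> (\<Sum>j\<in>J. (\<upsilon> m / \<gamma> m) * (\<gamma> j * (c j)\<^sup>2))"
      proof (rule sum_mono)
        fix j assume j: "j \<in> J"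
        then have "m \<le> j" using J by auto
        then show "(\<upsilon> j / \<gamma> j) * (\<gamma> j * (c j)\<^sup>2) \<le> (\<upsilon> m / \<gamma> m) * (\<gamma> j * (c j)\<^sup>2)"
          using \<gamma>J[OF j] \<gamma>[OF m] \<upsilon>[OF m] \<gamma>mono[OF m] \<upsilon>mono[OF m]
          by (intro mult_right_mono frac_le) auto
      qed
      also have "\<dots> = \<zeta> * (\<upsilon> m / \<gamma> m)" by (simp only: sum_distrib_left[symmetric] 1 mult.commute)
      finally have "real n * d * (\<Sum>j\<in>J. \<upsilon> j * (c j)\<^sup>2) \<le> real n * d * (\<zeta> * (\<upsilon> m / \<gamma> m))"
        using assms(8) by (intro mult_left_mono) auto
      also have "\<dots> \<le> 1 / 2"
        using \<alpha>(1) \<gamma>[OF m] \<upsilon>[OF m] by (intro scale) auto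
      finally have 2: "real n * d * (\<Sum>j\<in>J. \<upsilon> j * (c j)\<^sup>2) \<le> 1 / 2" .
      have "\<zeta> \<le> 1 * \<rho>" unfolding \<zeta>_def using \<kappa> \<beta> by (intro mult_mono) auto
      then show ?thesis
        using key[OF J(1) J1, of c] 1 2 unfolding val by (simp add: s_def)
    next
      case True
      then show ?thesis unfolding s_def[symmetric] by simp
    qed
  qed
  \<comment> \<open>The finite tail bounds are uniform in \<open>J\<close>, so they pass to the
    infinite sum, which converges because \<open>h\<close> lies in the dual space.\<close>
  have high: "ennreal (\<zeta> / 4 * (\<Sum>\<^sub>\<infinity>j\<in>{m<..}. (h j)\<^sup>2 / \<gamma> j)) \<le> ?R"
  proof (cases ?R)
    case (real r)
    have "(\<lambda>j. (h j)\<^sup>2 / \<gamma> j) summable_on {1..}"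
      using assms(6) by (simp add: F_space_def)
    then have "(\<lambda>j. (h j)\<^sup>2 / \<gamma> j) summable_on {m<..}"
      by (rule summable_on_subset_banach) auto
    then have "(\<Sum>\<^sub>\<infinity>j\<in>{m<..}. (h j)\<^sup>2 / \<gamma> j) \<le> 2 * r / \<zeta>"
    proof (rule infsum_le_finite_sums)
      fix J assume "finite J" "J \<subseteq> {m<..}"
      then have "ennreal (\<zeta> / 2 * (\<Sum>j\<in>J. (h j)\<^sup>2 / \<gamma> j)) \<le> ennreal r"
        using tail real by simp
      then have "\<zeta> / 2 * (\<Sum>j\<in>J. (h j)\<^sup>2 / \<gamma> j) \<le> r" using real by (simp add: ennreal_le_iff)
      then show "(\<Sum>j\<in>J. (h j)\<^sup>2 / \<gamma> j) \<le> 2 * r / \<zeta>" using \<zeta> by (simp add: field_simps)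
    qed
    then have "\<zeta> / 4 * (\<Sum>\<^sub>\<infinity>j\<in>{m<..}. (h j)\<^sup>2 / \<gamma> j) \<le> r / 2" using \<zeta> by (simp add: field_simps)
    also have "\<dots> \<le> r" using real by simp
    finally show ?thesis unfolding real by (rule ennreal_leI)
  next
    case top
    show ?thesis unfolding top by (rule top_greatest)
  qed
  have "kappa \<gamma> \<upsilon> / 4 * min (1 / (2 * d)) \<rho> * rate \<gamma> \<upsilon> h (real n) =
      \<zeta> / 4 * max (\<alpha> * (\<Sum>j=1..m. (h j)\<^sup>2 / \<upsilon> j)) (\<Sum>\<^sub>\<infinity>j\<in>{m<..}. (h j)\<^sup>2 / \<gamma> j)"
    by (simp add: \<zeta>_def \<kappa>_def \<beta>_def rate_def \<alpha>_def m_def)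
  then show "ennreal (kappa \<gamma> \<upsilon> / 4 * min (1 / (2 * d)) \<rho> * rate \<gamma> \<upsilon> h (real n)) \<le> ?R"
    using low high by (simp add: max_def)
qed

end
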